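(* Let $m,n>1$ be integers with $m\neq n$, and let $r$ be a positive integer. Then $\chi_{la}(rK_{m,n})=2$ whenever either $m,n,r$ are all odd, or $m,n$ are both even with $(m,n)\neq(2,2)$.
   Context: All graphs are simple and finite. Let $G=(V,E)$ be a graph without isolated vertices. For a bijection $f:E\to\{1,2,\dots,|E|\}$ and a vertex $u$, the weight of $u$ is $w(u)=\sum_{e\in E(u)}f(e)$, where $E(u)$ is the set of edges incident to $u$. The bijection $f$ is a local antimagic labeling of $G$ if $w(u)\neq w(v)$ for every edge $uv\in E$; it then induces a proper vertex coloring of $G$ in which $v$ gets color $w(v)$. The local antimagic chromatic number $\chi_{la}(G)$ is the minimum number of distinct colors (distinct values of $w$) over all local antimagic labelings of $G$. $K_{m,n}$ is the complete bipartite graph with parts of sizes $m$ and $n$, and $rK_{m,n}$ is the disjoint union of $r$ copies of $K_{m,n}$ (the labels $1,\dots,rmn$ being used across the whole graph). *)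

theory Defs
  imports Main "HOL-Library.Extended_Nat"
begin

record 'a ugraph =
  verts :: "'a set"
  edges :: "'a set set"

definition simple_graph :: "'a ugraph \<Rightarrow> bool" where
  "simple_graph G \<longleftrightarrow> finite (verts G) \<and> (\<forall>e\<in>edges G. e \<subseteq> verts G \<and> card e = 2)"

definition incident_edges :: "'a ugraph \<Rightarrow> 'a \<Rightarrow> 'a set set" where
  "incident_edges G u = {e \<in> edges G. u \<in> e}"

definition no_isolated_vertices :: "'a ugraph \<Rightarrow> bool" where
  "no_isolated_vertices G \<longleftrightarrow> (\<forall>u\<in>verts G. incident_edges G u \<noteq> {})"

definition weight :: "'a ugraph \<Rightarrow> ('a set \<Rightarrow> nat) \<Rightarrow> 'a \<Rightarrow> nat" where
  "weight G f u = (\<Sum>e\<in>incident_edges G u. f e)"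

definition local_antimagic_labeling :: "'a ugraph \<Rightarrow> ('a set \<Rightarrow> nat) \<Rightarrow> bool" where
  "local_antimagic_labeling G f \<longleftrightarrow>
     bij_betw f (edges G) {1..card (edges G)} \<and>
     (\<forall>u v. {u, v} \<in> edges G \<longrightarrow> weight G f u \<noteq> weight G f v)"

text \<open>
  The infimum is taken in \<open>enat\<close>, so that the value is \<open>\<infinity>\<close> if \<open>G\<close> has no local
  antimagic labeling; otherwise it is an attained minimum. In particular, a finite value
  entails that a labeling exists.
\<close>
definition chi_la :: "'a ugraph \<Rightarrow> enat" where
  "chi_la G = (INF f\<in>{f. local_antimagic_labeling G f}. enat (card (weight G f ` verts G)))"

definition complete_bipartite :: "nat \<Rightarrow> nat \<Rightarrow> (nat + nat) ugraph" where
  "complete_bipartite m n =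
     \<lparr> verts = {..<m} <+> {..<n},
       edges = {{Inl i, Inr j} | i j. i < m \<and> j < n} \<rparr>"

definition disjoint_copies :: "nat \<Rightarrow> 'a ugraph \<Rightarrow> (nat \<times> 'a) ugraph" where
  "disjoint_copies r G =
     \<lparr> verts = {..<r} \<times> verts G,
       edges = {Pair k ` e | k e. k < r \<and> e \<in> edges G} \<rparr>"

lemma simple_graph_complete_bipartite: "simple_graph (complete_bipartite m n)"
  by (auto simp: simple_graph_def complete_bipartite_def)

lemma simple_graph_disjoint_copies:
  assumes "simple_graph G"
  shows "simple_graph (disjoint_copies r G)"
  using assms
  by (auto simp: simple_graph_def disjoint_copies_def card_image inj_on_def)

lemma no_isolated_vertices_complete_bipartite:
  assumes "m > 0" "n > 0"
  shows "no_isolated_vertices (complete_bipartite m n)"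
proof -
  have "\<exists>e. e \<in> incident_edges (complete_bipartite m n) u"
    if "u \<in> verts (complete_bipartite m n)" for u
  proof (cases u)
    case (Inl i)
    then have "{Inl i, Inr 0} \<in> incident_edges (complete_bipartite m n) u"
      using that assms by (auto simp: incident_edges_def complete_bipartite_def)
    then show ?thesis by blast
  next
    case (Inr j)
    then have "{Inl 0, Inr j} \<in> incident_edges (complete_bipartite m n) u"
      using that assms by (auto simp: incident_edges_def complete_bipartite_def)
    then show ?thesis by blast
  qed
  then show ?thesis by (auto simp: no_isolated_vertices_def)
qed

lemma no_isolated_vertices_disjoint_copies:
  assumes "no_isolated_vertices G"
  shows "no_isolated_vertices (disjoint_copies r G)"
  unfolding no_isolated_vertices_def
proof
  fix x
  assume "x \<in> verts (disjoint_copies r G)"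
  then obtain k u where x: "x = (k, u)" "k < r" "u \<in> verts G"
    by (auto simp: disjoint_copies_def)
  then obtain e where "e \<in> edges G" "u \<in> e"
    using assms by (auto simp: no_isolated_vertices_def incident_edges_def)
  with x have "Pair k ` e \<in> incident_edges (disjoint_copies r G) x"
    unfolding incident_edges_def disjoint_copies_def by simp blast
  then show "incident_edges (disjoint_copies r G) x \<noteq> {}" by blast
qed

lemma chi_la_attained:
  assumes "local_antimagic_labeling G f"
  shows "\<exists>g. local_antimagic_labeling G g \<and> chi_la G = enat (card (weight G g ` verts G))"
proof -
  let ?A = "(\<lambda>f. enat (card (weight G f ` verts G))) ` {f. local_antimagic_labeling G f}"
  have "enat (card (weight G f ` verts G)) \<in> ?A" using assms by blast
  then have "Inf ?A \<in> ?A" by (rule wellorder_InfI)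
  then show ?thesis unfolding chi_la_def by blast
qed

end

theory Submission
  imports Defs
begin

text \<open>Two colours are necessary because there is an edge. For the converse it suffices to distribute
  \<open>1, \<dots>, rmn\<close> over \<open>r\<close> arrays of size \<open>m \<times> n\<close> such that all row sums agree and all column sums
  agree: the two constants then have ratio \<open>n : m\<close>, so they differ. After centring the labels
  about \<open>0\<close>, all these sums have to be \<open>0\<close>.

  For even \<open>m, n\<close> the arrays are stacked from strips of two rows, one being the negative of the other.

  For odd \<open>m < n = 2h + 1\<close> and a single array, write a value as \<open>n a + x\<close> with digits
  \<open>\<bar>a\<bar> \<le> (m - 1) / 2\<close> and \<open>\<bar>x\<bar> \<le> h\<close>. A \<open>3 \<times> n\<close> array comes from three permutations of
  \<open>{-h..h}\<close> with sum zero; four rows at a time are then added with the leading digits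
  \<open>\<plusminus>a, \<plusminus>(a + 1)\<close>. The step from three rows to five needs a strip of two rows, which exists for
  \<open>n \<ge> 9\<close>; sizes \<open>3 \<times> 5\<close> and \<open>5 \<times> 7\<close> are given explicitly. Finally, \<open>r\<close> arrays arise from
  one by a further digit.\<close>

section \<open>Zero-sum arrays\<close>

text \<open>The condition on \<open>card V\<close>, which equals the number of cells, makes the
  entries pairwise distinct: every element of \<open>V\<close> occurs in exactly one cell.\<close>

definition zero_sum_arrays :: "int set \<Rightarrow> nat \<Rightarrow> nat \<Rightarrow> nat \<Rightarrow> bool" where
  "zero_sum_arrays V r m n \<longleftrightarrow> card V = r * m * n \<and>
     (\<exists>f. V = {f k i j | k i j. k < r \<and> i < m \<and> j < n} \<and>
          (\<forall>k<r. \<forall>i<m. (\<Sum>j<n. f k i j) = 0) \<and>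
          (\<forall>k<r. \<forall>j<n. (\<Sum>i<m. f k i j) = 0))"

lemma zero_sum_arraysI:
  assumes "card V = r * m * n"
    and "\<And>k i j. k < r \<Longrightarrow> i < m \<Longrightarrow> j < n \<Longrightarrow> f k i j \<in> V"
    and "\<And>x. x \<in> V \<Longrightarrow> \<exists>k<r. \<exists>i<m. \<exists>j<n. x = f k i j"
    and "\<And>k i. k < r \<Longrightarrow> i < m \<Longrightarrow> (\<Sum>j<n. f k i j) = 0"
    and "\<And>k j. k < r \<Longrightarrow> j < n \<Longrightarrow> (\<Sum>i<m. f k i j) = 0"
  shows "zero_sum_arrays V r m n"
proof -
  have "V = {f k i j | k i j. k < r \<and> i < m \<and> j < n}"
    using assms(2,3) by blast
  then show ?thesis
    unfolding zero_sum_arrays_def using assms(1,4,5) by blast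
qed

lemma zero_sum_arraysD:
  assumes "zero_sum_arrays V r m n"
  shows "\<exists>f. (\<forall>k<r. \<forall>i<m. \<forall>j<n. f k i j \<in> V) \<and> (\<forall>x\<in>V. \<exists>k<r. \<exists>i<m. \<exists>j<n. x = f k i j) \<and>
    (\<forall>k<r. \<forall>i<m. (\<Sum>j<n. f k i j) = 0) \<and> (\<forall>k<r. \<forall>j<n. (\<Sum>i<m. f k i j) = 0)"
  using assms unfolding zero_sum_arrays_def by blast

lemma zero_sum_arrays_finite:
  assumes "zero_sum_arrays V r m n"
  shows "finite V"
proof -
  obtain f where V: "V = {f k i j | k i j. k < r \<and> i < m \<and> j < n}"
    using assms unfolding zero_sum_arrays_def by blast
  have "V \<subseteq> (\<lambda>(k, i, j). f k i j) ` ({..<r} \<times> {..<m} \<times> {..<n})"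
    unfolding V by force
  then show ?thesis
    by (rule finite_subset) auto
qed

lemma sum_lessThan_append:
  fixes u v :: "nat \<Rightarrow> int"
  shows "(\<Sum>j<n + n'. if j < n then u j else v (j - n)) = (\<Sum>j<n. u j) + (\<Sum>j<n'. v j)"
  by (induction n') auto

text \<open>Sums and images do not depend on how rows and columns are named, so rows may be named by
  signs or digits and columns by integers.\<close>

lemma zero_sum_array_indexedI:
  fixes g :: "'a \<Rightarrow> 'b \<Rightarrow> int"
  assumes "finite I" "card I = m" "finite J" "card J = n"
    and V: "\<And>i j. i \<in> I \<Longrightarrow> j \<in> J \<Longrightarrow> g i j \<in> V"
      "\<And>x. x \<in> V \<Longrightarrow> \<exists>i\<in>I. \<exists>j\<in>J. x = g i j"
    and "card V = m * n"
    and rows: "\<And>i. i \<in> I \<Longrightarrow> (\<Sum>j\<in>J. g i j) = 0"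
    and cols: "\<And>j. j \<in> J \<Longrightarrow> (\<Sum>i\<in>I. g i j) = 0"
  shows "zero_sum_arrays V 1 m n"
proof -
  obtain p where p: "bij_betw p {..<m} I"
    using ex_bij_betw_nat_finite[OF assms(1)] assms(2) by (auto simp: atLeast0LessThan)
  obtain q where q: "bij_betw q {..<n} J"
    using ex_bij_betw_nat_finite[OF assms(3)] assms(4) by (auto simp: atLeast0LessThan)
  have pI: "p i \<in> I" if "i < m" for i
    using p that by (auto simp: bij_betw_def)
  have qJ: "q j \<in> J" if "j < n" for j
    using q that by (auto simp: bij_betw_def)
  show ?thesis
  proof (rule zero_sum_arraysI[where f = "\<lambda>k i j. g (p i) (q j)"])
    fix x
    assume "x \<in> V"
    then obtain i j where "i \<in> I" "j \<in> J" "x = g i j"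
      using V(2) by blast
    moreover obtain i' where "i' < m" "i = p i'"
      using p \<open>i \<in> I\<close> by (auto simp: bij_betw_def)
    moreover obtain j' where "j' < n" "j = q j'"
      using q \<open>j \<in> J\<close> by (auto simp: bij_betw_def)
    ultimately show "\<exists>k<1::nat. \<exists>i<m. \<exists>j<n. x = g (p i) (q j)"
      by auto
  next
    show "(\<Sum>j<n. g (p i) (q j)) = 0" if "i < m" for i
      using rows[OF pI[OF that]] sum.reindex_bij_betw[OF q, of "g (p i)"] by simp
    show "(\<Sum>i<m. g (p i) (q j)) = 0" if "j < n" for j
      using cols[OF qJ[OF that]] sum.reindex_bij_betw[OF p, of "\<lambda>i. g i (q j)"] by simp
  qed (use V(1) pI qJ \<open>card V = m * n\<close> in auto)
qed

section \<open>Transposing, juxtaposing and stacking arrays\<close>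

lemma zero_sum_arrays_transpose:
  assumes "zero_sum_arrays V r m n"
  shows "zero_sum_arrays V r n m"
proof -
  obtain f where f: "card V = r * m * n"
    "\<And>k i j. k < r \<Longrightarrow> i < m \<Longrightarrow> j < n \<Longrightarrow> f k i j \<in> V"
    "\<And>x. x \<in> V \<Longrightarrow> \<exists>k<r. \<exists>i<m. \<exists>j<n. x = f k i j"
    "\<And>k i. k < r \<Longrightarrow> i < m \<Longrightarrow> (\<Sum>j<n. f k i j) = 0"
    "\<And>k j. k < r \<Longrightarrow> j < n \<Longrightarrow> (\<Sum>i<m. f k i j) = 0"
    using assms unfolding zero_sum_arrays_def by blast
  show ?thesis
  proof (rule zero_sum_arraysI[where f = "\<lambda>k i j. f k j i"])
    show "card V = r * n * m"
      using f(1) by simp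
    show "\<exists>k<r. \<exists>i<n. \<exists>j<m. x = f k j i" if "x \<in> V" for x
      using f(3)[OF that] by blast
  qed (use f(2,4,5) in auto)
qed

lemma zero_sum_arrays_append_copies:
  assumes "zero_sum_arrays V r m n" "zero_sum_arrays V' r' m n" "V \<inter> V' = {}"
  shows "zero_sum_arrays (V \<union> V') (r + r') m n"
proof -
  obtain f where f: "card V = r * m * n"
    "\<And>k i j. k < r \<Longrightarrow> i < m \<Longrightarrow> j < n \<Longrightarrow> f k i j \<in> V"
    "\<And>x. x \<in> V \<Longrightarrow> \<exists>k<r. \<exists>i<m. \<exists>j<n. x = f k i j"
    "\<And>k i. k < r \<Longrightarrow> i < m \<Longrightarrow> (\<Sum>j<n. f k i j) = 0"
    "\<And>k j. k < r \<Longrightarrow> j < n \<Longrightarrow> (\<Sum>i<m. f k i j) = 0"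
    using assms(1) unfolding zero_sum_arrays_def by blast
  obtain f' where f': "card V' = r' * m * n"
    "\<And>k i j. k < r' \<Longrightarrow> i < m \<Longrightarrow> j < n \<Longrightarrow> f' k i j \<in> V'"
    "\<And>x. x \<in> V' \<Longrightarrow> \<exists>k<r'. \<exists>i<m. \<exists>j<n. x = f' k i j"
    "\<And>k i. k < r' \<Longrightarrow> i < m \<Longrightarrow> (\<Sum>j<n. f' k i j) = 0"
    "\<And>k j. k < r' \<Longrightarrow> j < n \<Longrightarrow> (\<Sum>i<m. f' k i j) = 0"
    using assms(2) unfolding zero_sum_arrays_def by blast
  define F where "F k = (if k < r then f k else f' (k - r))" for k
  have F: "F k = f k" if "k < r" for k
    using that by (simp add: F_def)
  have F': "F (r + k) = f' k" for k
    by (simp add: F_def)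
  have split: "k < r \<or> (\<exists>k'<r'. k = r + k')" if "k < r + r'" for k
    using that by presburger
  show ?thesis
  proof (rule zero_sum_arraysI[where f = F])
    show "card (V \<union> V') = (r + r') * m * n"
      using assms(3) f(1) f'(1) zero_sum_arrays_finite[OF assms(1)] zero_sum_arrays_finite[OF assms(2)]
      by (simp add: card_Un_disjoint algebra_simps)
    show "F k i j \<in> V \<union> V'" if "k < r + r'" "i < m" "j < n" for k i j
      using split[OF that(1)] that f(2) f'(2) F F' by auto
    show "\<exists>k<r + r'. \<exists>i<m. \<exists>j<n. x = F k i j" if "x \<in> V \<union> V'" for x
    proof (cases "x \<in> V")
      case True
      then show ?thesis
        using f(3) F trans_less_add1 by metis
    next
      case False
      then show ?thesis
        using f'(3)[of x] F' that nat_add_left_cancel_less by (metis Un_iff)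
    qed
    show "(\<Sum>j<n. F k i j) = 0" if "k < r + r'" "i < m" for k i
      using split[OF that(1)] that f(4) f'(4) F F' by auto
    show "(\<Sum>i<m. F k i j) = 0" if "k < r + r'" "j < n" for k j
      using split[OF that(1)] that f(5) f'(5) F F' by auto
  qed
qed

lemma zero_sum_arrays_append_columns:
  assumes "zero_sum_arrays V r m n" "zero_sum_arrays V' r m n'" "V \<inter> V' = {}"
  shows "zero_sum_arrays (V \<union> V') r m (n + n')"
proof -
  obtain f where f: "card V = r * m * n"
    "\<And>k i j. k < r \<Longrightarrow> i < m \<Longrightarrow> j < n \<Longrightarrow> f k i j \<in> V"
    "\<And>x. x \<in> V \<Longrightarrow> \<exists>k<r. \<exists>i<m. \<exists>j<n. x = f k i j"
    "\<And>k i. k < r \<Longrightarrow> i < m \<Longrightarrow> (\<Sum>j<n. f k i j) = 0"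
    "\<And>k j. k < r \<Longrightarrow> j < n \<Longrightarrow> (\<Sum>i<m. f k i j) = 0"
    using assms(1) unfolding zero_sum_arrays_def by blast
  obtain f' where f': "card V' = r * m * n'"
    "\<And>k i j. k < r \<Longrightarrow> i < m \<Longrightarrow> j < n' \<Longrightarrow> f' k i j \<in> V'"
    "\<And>x. x \<in> V' \<Longrightarrow> \<exists>k<r. \<exists>i<m. \<exists>j<n'. x = f' k i j"
    "\<And>k i. k < r \<Longrightarrow> i < m \<Longrightarrow> (\<Sum>j<n'. f' k i j) = 0"
    "\<And>k j. k < r \<Longrightarrow> j < n' \<Longrightarrow> (\<Sum>i<m. f' k i j) = 0"
    using assms(2) unfolding zero_sum_arrays_def by blast
  define F where "F k i j = (if j < n then f k i j else f' k i (j - n))" for k i j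
  have F: "F k i j = f k i j" if "j < n" for k i j
    using that by (simp add: F_def)
  have F': "F k i (n + j) = f' k i j" for k i j
    by (simp add: F_def)
  have split: "j < n \<or> (\<exists>j'<n'. j = n + j')" if "j < n + n'" for j
    using that by presburger
  show ?thesis
  proof (rule zero_sum_arraysI[where f = F])
    show "card (V \<union> V') = r * m * (n + n')"
      using assms(3) f(1) f'(1) zero_sum_arrays_finite[OF assms(1)] zero_sum_arrays_finite[OF assms(2)]
      by (simp add: card_Un_disjoint algebra_simps)
    show "F k i j \<in> V \<union> V'" if "k < r" "i < m" "j < n + n'" for k i j
      using split[OF that(3)] that f(2) f'(2) F F' by auto
    show "\<exists>k<r. \<exists>i<m. \<exists>j<n + n'. x = F k i j" if "x \<in> V \<union> V'" for x
    proof (cases "x \<in> V")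
      case True
      then show ?thesis
        using f(3) F trans_less_add1 by metis
    next
      case False
      then show ?thesis
        using f'(3)[of x] F' that nat_add_left_cancel_less by (metis Un_iff)
    qed
    show "(\<Sum>j<n + n'. F k i j) = 0" if "k < r" "i < m" for k i
      using that f(4) f'(4) by (simp add: F_def sum_lessThan_append)
    show "(\<Sum>i<m. F k i j) = 0" if "k < r" "j < n + n'" for k j
      using split[OF that(2)] that f(5) f'(5) F F' by auto
  qed
qed

lemma zero_sum_arrays_append_rows:
  assumes "zero_sum_arrays V r m n" "zero_sum_arrays V' r m' n" "V \<inter> V' = {}"
  shows "zero_sum_arrays (V \<union> V') r (m + m') n"
  using assms by (intro zero_sum_arrays_transpose[of _ _ n] zero_sum_arrays_append_columns) (auto intro: zero_sum_arrays_transpose)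

text \<open>The \<open>k\<close> arrays numbered from \<open>l * k\<close> on are placed on top of
  each other. Rows are unchanged, and each new column sum consists of \<open>k\<close> old
  ones.\<close>

lemma zero_sum_arrays_stack:
  assumes "zero_sum_arrays V (r * k) m n"
  shows "zero_sum_arrays V r (k * m) n"
proof -
  obtain f where f: "card V = r * k * m * n"
    "\<And>l i j. l < r * k \<Longrightarrow> i < m \<Longrightarrow> j < n \<Longrightarrow> f l i j \<in> V"
    "\<And>x. x \<in> V \<Longrightarrow> \<exists>l<r * k. \<exists>i<m. \<exists>j<n. x = f l i j"
    "\<And>l i. l < r * k \<Longrightarrow> i < m \<Longrightarrow> (\<Sum>j<n. f l i j) = 0"
    "\<And>l j. l < r * k \<Longrightarrow> j < n \<Longrightarrow> (\<Sum>i<m. f l i j) = 0"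
    using assms unfolding zero_sum_arrays_def by blast
  define F where "F l i j = f (l * k + i div m) (i mod m) j" for l i j
  have lt: "l * k + t < r * k" if "l < r" "t < k" for l t
  proof -
    have "l * k + t < (l + 1) * k" using that by simp
    also have "\<dots> \<le> r * k" using that by (intro mult_right_mono) auto
    finally show ?thesis .
  qed
  have lt': "l * k + i div m < r * k" "i mod m < m" if "l < r" "i < k * m" for l i
  proof -
    have "m > 0" using that by (cases "m = 0") auto
    then show "l * k + i div m < r * k" "i mod m < m"
      using that by (auto intro!: lt simp: less_mult_imp_div_less)
  qed
  show ?thesis
  proof (rule zero_sum_arraysI[where f = F])
    show "card V = r * (k * m) * n"
      using f(1) by simp
    show "F l i j \<in> V" if "l < r" "i < k * m" "j < n" for l i j
      unfolding F_def using lt'[OF that(1,2)] that by (intro f(2))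
    show "\<exists>l<r. \<exists>i<k * m. \<exists>j<n. x = F l i j" if x: "x \<in> V" for x
    proof -
      obtain l i j where l: "l < r * k" "i < m" "j < n" "x = f l i j"
        using f(3)[OF x] by blast
      have k: "k > 0" using l by (cases "k = 0") auto
      have "l mod k * m + i < (l mod k + 1) * m" using l by simp
      also have "\<dots> \<le> k * m" using k by (intro mult_right_mono) (simp_all add: Suc_leI)
      finally have "l mod k * m + i < k * m" .
      moreover have "l div k < r" using l by (simp add: less_mult_imp_div_less)
      moreover have "x = F (l div k) (l mod k * m + i) j"
        unfolding F_def using l by simp
      ultimately show ?thesis
        using l(3) by blast
    qed
    show "(\<Sum>j<n. F l i j) = 0" if "l < r" "i < k * m" for l i
      using f(4) lt'[OF that] by (simp add: F_def)
    show "(\<Sum>i<k * m. F l i j) = 0" if "l < r" "j < n" for l j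
    proof -
      have "(\<Sum>i<k * m. F l i j) = (\<Sum>t<k. sum (\<lambda>i. F l i j) {t * m..<t * m + m})"
        by (rule sum.nat_group[symmetric])
      also have "\<dots> = (\<Sum>t<k. 0)"
      proof (rule sum.cong)
        fix t assume t: "t \<in> {..<k}"
        have "sum (\<lambda>i. F l i j) {t * m..<t * m + m} = sum (\<lambda>i. F l (i + t * m) j) {0..<m}"
          using sum.shift_bounds_nat_ivl[of "\<lambda>i. F l i j" 0 "t * m" m] by (simp add: add.commute)
        also have "\<dots> = (\<Sum>i<m. f (l * k + t) i j)"
          by (intro sum.cong) (auto simp: F_def)
        finally show "sum (\<lambda>i. F l i j) {t * m..<t * m + m} = 0"
          using f(5) that lt[of l t] t by simp
      qed simp
      finally show ?thesis by simp
    qed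
  qed
qed

text \<open>One row lists \<open>W\<close> and the other the negatives in the same order, so columns
  cancel; disjointness keeps the \<open>2 * n\<close> entries distinct.\<close>

lemma zero_sum_two_rows:
  fixes W :: "int set"
  assumes "finite W" "card W = n" "\<Sum>W = 0" "W \<inter> uminus ` W = {}"
  shows "zero_sum_arrays (W \<union> uminus ` W) 1 2 n"
proof (rule zero_sum_array_indexedI[where I = "{1, -1 :: int}" and J = W and g = "\<lambda>i j. i * j"])
  show "card (W \<union> uminus ` W) = 2 * n"
    using assms by (subst card_Un_disjoint) (auto simp: card_image)
qed (use assms in \<open>auto simp: sum_negf\<close>)

section \<open>Even sizes\<close>

text \<open>For even sizes the values are odd integers: these are symmetric about \<open>0\<close> without containing it.\<close>

definition odds :: "nat set \<Rightarrow> int set" where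
  "odds K = {x. \<exists>k\<in>K. \<bar>x\<bar> = 2 * int k + 1}"

lemma odds_Un: "odds (K \<union> K') = odds K \<union> odds K'"
  unfolding odds_def by auto

lemma odds_disjoint: "K \<inter> K' = {} \<Longrightarrow> odds K \<inter> odds K' = {}"
  unfolding odds_def by auto

lemma odds_empty: "odds {} = {}"
  unfolding odds_def by simp

lemma odds_lessThan: "odds {..<N} = {x. odd x \<and> \<bar>x\<bar> < 2 * int N}"
proof (intro set_eqI iffI)
  fix x
  assume x: "x \<in> {x. odd x \<and> \<bar>x\<bar> < 2 * int N}"
  then have "\<bar>x\<bar> = 2 * int (nat (\<bar>x\<bar> div 2)) + 1"
    by auto
  moreover have "nat (\<bar>x\<bar> div 2) < N"
    using x by auto
  ultimately show "x \<in> odds {..<N}"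
    unfolding odds_def by blast
next
  fix x
  assume "x \<in> odds {..<N}"
  then obtain k where k: "k < N" "\<bar>x\<bar> = 2 * int k + 1"
    unfolding odds_def by blast
  moreover have "odd x"
    using k(2) by presburger
  ultimately show "x \<in> {x. odd x \<and> \<bar>x\<bar> < 2 * int N}"
    by simp
qed

text \<open>Elements of \<open>T\<close> receive the sign plus and those of \<open>T'\<close> the
  sign minus. The signed odd numbers form a row with sum zero, and their negatives are the other
  row.\<close>

lemma odds_two_rows:
  assumes "finite T" "finite T'" "T \<inter> T' = {}"
    "(\<Sum>k\<in>T. 2 * k + 1) = (\<Sum>k\<in>T'. 2 * k + 1)" "card T + card T' = n"
  shows "zero_sum_arrays (odds (T \<union> T')) 1 2 n"
proof -
  define p where "p k = 2 * int k + 1" for k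
  let ?W = "p ` T \<union> (\<lambda>k. - p k) ` T'"
  have inj: "inj_on p A" "inj_on (\<lambda>k. - p k) A" for A
    unfolding p_def inj_on_def by auto
  have pos: "p k > 0" for k unfolding p_def by simp
  have ne: "p k \<noteq> - p l" "- p l \<noteq> p k" for k l
    using pos[of k] pos[of l] by linarith+
  have disj: "p ` T \<inter> (\<lambda>k. - p k) ` T' = {}"
    using ne by auto
  have "\<Sum>?W = (\<Sum>k\<in>T. p k) - (\<Sum>k\<in>T'. p k)"
    using assms disj by (simp add: sum.union_disjoint sum.reindex[OF inj(1)] sum.reindex[OF inj(2)] sum_negf)
  also have "\<dots> = int (\<Sum>k\<in>T. 2 * k + 1) - int (\<Sum>k\<in>T'. 2 * k + 1)"
    by (simp add: p_def add.commute)
  finally have sum: "\<Sum>?W = 0"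
    unfolding assms(4) by simp
  have card: "card ?W = n"
    using assms disj by (simp add: card_Un_disjoint card_image inj)
  have "p k \<noteq> p l" if "k \<in> T" "l \<in> T'" for k l
    using assms(3) that unfolding p_def by auto
  then have neg: "?W \<inter> uminus ` ?W = {}"
    using ne by (auto simp: image_iff) metis+
  have "\<bar>x\<bar> = p k \<longleftrightarrow> x = p k \<or> x = - p k" for x k
    using pos[of k] by linarith
  then have "odds (T \<union> T') = (\<Union>k\<in>T \<union> T'. {p k, - p k})"
    unfolding odds_def p_def[symmetric] by auto
  also have "\<dots> = ?W \<union> (p ` T' \<union> (\<lambda>k. - p k) ` T)"
    by auto
  also have "p ` T' \<union> (\<lambda>k. - p k) ` T = uminus ` ?W"
    by (auto simp: image_Un image_image)
  finally have "odds (T \<union> T') = ?W \<union> uminus ` ?W" .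
  then show ?thesis
    using zero_sum_two_rows[OF _ card sum neg] assms by simp
qed

lemma odds_four: "zero_sum_arrays (odds {L..<L + 4}) 1 2 4"
proof -
  have "{L..<L + 4} = {L, L + 3} \<union> {L + 1, L + 2}"
    by auto
  then show ?thesis
    using odds_two_rows[of "{L, L + 3}" "{L + 1, L + 2}" 4] by simp
qed

lemma odds_six: "zero_sum_arrays (odds {0..<6}) 1 2 6"
proof -
  have "{0..<6} = {3, 5} \<union> {0, 1, 2, 4::nat}"
    by auto
  then show ?thesis
    using odds_two_rows[of "{3, 5}" "{0, 1, 2, 4}" 6] by simp
qed

text \<open>Beyond the first few, six consecutive odd numbers admit no signed zero sum; but twelve of
  them split into two six-element sets that do.\<close>

lemma odds_twelve: "zero_sum_arrays (odds {L..<L + 12}) 2 2 6"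
proof -
  \<comment> \<open>Apart from the multiples of \<open>L\<close>, the index sums are 8 for
    \<open>?A\<close> and \<open>?B\<close>, and 25 for \<open>?C\<close> and
    \<open>?D\<close>.\<close>
  let ?A = "{L, L + 2, L + 6}" and ?B = "{L + 1, L + 3, L + 4}"
  let ?C = "{L + 5, L + 9, L + 11}" and ?D = "{L + 7, L + 8, L + 10}"
  have "{L..<L + 12} \<subseteq> ?A \<union> ?B \<union> (?C \<union> ?D)"
  proof
    fix x
    assume "x \<in> {L..<L + 12}"
    then obtain y where "x = L + y" "y \<in> {..<12}"
      by (auto simp: le_iff_add)
    moreover have "{..<12} = {0, 1, 2, 3, 4, 5, 6, 7, 8, 9, 10, 11::nat}"
      by (auto simp: eval_nat_numeral less_Suc_eq)
    ultimately show "x \<in> ?A \<union> ?B \<union> (?C \<union> ?D)" by auto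
  qed
  then have eq: "{L..<L + 12} = ?A \<union> ?B \<union> (?C \<union> ?D)"
    by auto
  have "zero_sum_arrays (odds (?A \<union> ?B)) 1 2 6" "zero_sum_arrays (odds (?C \<union> ?D)) 1 2 6"
    using odds_two_rows[of ?A ?B 6] odds_two_rows[of ?C ?D 6] by simp_all
  then have "zero_sum_arrays (odds (?A \<union> ?B) \<union> odds (?C \<union> ?D)) (1 + 1) 2 6"
    by (rule zero_sum_arrays_append_copies) (rule odds_disjoint, simp)
  then show ?thesis
    unfolding eq odds_Un by (simp only: one_add_one)
qed

lemma odds_four_copies: "zero_sum_arrays (odds {L..<L + 4 * N}) N 2 4"
proof (induction N)
  case 0
  show ?case by (simp add: zero_sum_arrays_def odds_empty)
next
  case (Suc N)
  from zero_sum_arrays_append_copies[OF Suc odds_four[of "L + 4 * N"] odds_disjoint[OF ivl_disj_int_two(3)]]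
  show ?case by (simp add: ivl_disj_un_two(3) algebra_simps flip: odds_Un)
qed

text \<open>Copies are added in pairs, since \<open>odds_twelve\<close> works at any offset; an odd
  \<open>N\<close> starts from the block \<open>{0..<6}\<close>, which has a signed zero sum on its
  own.\<close>

lemma odds_six_copies: "zero_sum_arrays (odds {0..<6 * N}) N 2 6"
proof (induction N rule: nat_induct2)
  case 0
  show ?case by (simp add: zero_sum_arrays_def odds_empty)
next
  case 1
  show ?case using odds_six by simp
next
  case (step N)
  from zero_sum_arrays_append_copies[OF step odds_twelve[of "6 * N"] odds_disjoint[OF ivl_disj_int_two(3)]]
  show ?case by (simp add: ivl_disj_un_two(3) algebra_simps flip: odds_Un)
qed

lemma odds_four_mult_copies: "zero_sum_arrays (odds {L..<L + 4 * N * t}) N 2 (4 * t)"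
proof (induction t)
  case 0
  show ?case by (simp add: zero_sum_arrays_def odds_empty)
next
  case (Suc t)
  from zero_sum_arrays_append_columns[OF Suc odds_four_copies[of "L + 4 * N * t" N] odds_disjoint[OF ivl_disj_int_two(3)]]
  show ?case by (simp add: ivl_disj_un_two(3) algebra_simps flip: odds_Un)
qed

text \<open>An even width is \<open>4 * t\<close> or \<open>6 + 4 * t\<close>, so blocks of width
  four and at most one of width six suffice.\<close>

lemma odds_even_copies:
  assumes "even n" "n \<ge> 4"
  shows "zero_sum_arrays (odds {0..<N * n}) N 2 n"
proof (cases "4 dvd n")
  case True
  then obtain t where "n = 4 * t" by blast
  then show ?thesis using odds_four_mult_copies[of 0 N t] by (simp add: algebra_simps)
next
  case False
  then have "\<exists>t. n = 6 + 4 * t" using assms by presburger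
  then obtain t where "n = 6 + 4 * t" ..
  then show ?thesis
    using zero_sum_arrays_append_columns[OF odds_six_copies[of N]
        odds_four_mult_copies[of "6 * N" N t] odds_disjoint[OF ivl_disj_int_two(3)]]
    by (simp add: ivl_disj_un_two(3) algebra_simps flip: odds_Un)
qed

lemma zero_sum_arrays_even_wide:
  assumes "even m" "even n" "n \<ge> 4"
  shows "zero_sum_arrays (odds {0..<r * (m div 2) * n}) r m n"
  using zero_sum_arrays_stack[OF odds_even_copies[OF assms(2,3)]] assms(1)
  by (metis dvd_div_mult_self)

lemma zero_sum_arrays_even:
  assumes "even m" "even n" "m > 1" "n > 1" "(m, n) \<noteq> (2, 2)"
  shows "zero_sum_arrays {x. odd x \<and> \<bar>x\<bar> < int (r * m * n)} r m n"
proof -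
  obtain m' n' where mn: "m = 2 * m'" "n = 2 * n'" using assms by blast
  have eq: "odds {0..<2 * r * m' * n'} = {x. odd x \<and> \<bar>x\<bar> < int (r * m * n)}"
    unfolding odds_lessThan atLeast0LessThan mn by (auto simp: algebra_simps)
  show ?thesis
  proof (cases "n \<ge> 4")
    case True
    then show ?thesis
      using zero_sum_arrays_even_wide[of m n r] assms eq mn by (simp add: algebra_simps)
  next
    case False
    \<comment> \<open>Strips need width at least four. In this case \<open>m\<close> is large
      enough, so the strips run along the other side.\<close>
    then have "n = 2" using assms mn by presburger
    then have "m \<ge> 4" using assms mn by simp
    then show ?thesis
      using zero_sum_arrays_transpose[OF zero_sum_arrays_even_wide[of n m r]] assms eq mn
      by (simp add: algebra_simps)
  qed
qed

section \<open>Odd sizes\<close>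

text \<open>The balanced numeral system in base \<open>2 * h + 1\<close>: last digits symmetric
  about \<open>0\<close> let negation act digitwise.\<close>

definition digit_values :: "int \<Rightarrow> int set \<Rightarrow> int set" where
  "digit_values h A = (\<lambda>(a, x). (2 * h + 1) * a + x) ` (A \<times> {-h..h})"

lemma mem_digit_values: "y \<in> digit_values h A \<longleftrightarrow> (\<exists>a\<in>A. \<exists>x\<in>{-h..h}. y = (2 * h + 1) * a + x)"
  unfolding digit_values_def by auto

text \<open>Adding \<open>h\<close> turns the last digit into a remainder modulo
  \<open>2 * h + 1\<close>, so division recovers the leading digit.\<close>

lemma digits_unique:
  fixes a a' x x' h :: int
  assumes "(2 * h + 1) * a + x = (2 * h + 1) * a' + x'" "x \<in> {-h..h}" "x' \<in> {-h..h}"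
  shows "a = a' \<and> x = x'"
proof -
  have "((2 * h + 1) * a + (x + h)) div (2 * h + 1) = a"
    using assms(2) by (simp add: div_pos_pos_trivial)
  moreover have "((2 * h + 1) * a' + (x' + h)) div (2 * h + 1) = a'"
    using assms(3) by (simp add: div_pos_pos_trivial)
  moreover have "(2 * h + 1) * a + (x + h) = (2 * h + 1) * a' + (x' + h)"
    using assms(1) by simp
  ultimately have "a = a'" by simp
  then show ?thesis using assms(1) by simp
qed

lemma digit_values_Un: "digit_values h (A \<union> B) = digit_values h A \<union> digit_values h B"
  unfolding digit_values_def by blast

lemma digit_values_disjoint:
  assumes "A \<inter> B = {}"
  shows "digit_values h A \<inter> digit_values h B = {}"
proof (rule equals0I)
  fix z
  assume z: "z \<in> digit_values h A \<inter> digit_values h B"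
  obtain a x where "z = (2 * h + 1) * a + x" "a \<in> A" "x \<in> {-h..h}"
    using z unfolding Int_iff mem_digit_values by blast
  moreover obtain b y where "z = (2 * h + 1) * b + y" "b \<in> B" "y \<in> {-h..h}"
    using z unfolding Int_iff mem_digit_values by blast
  ultimately show False
    using digits_unique[of h a x b y] assms by auto
qed

text \<open>The bound is half of \<open>(2 * g + 1) * (2 * h + 1) - 1\<close>: the digit pairs fill
  a symmetric interval without gaps.\<close>

lemma digit_values_interval:
  assumes "h \<ge> 0" "g \<ge> 0"
  shows "digit_values h {-g..g} = {-(2 * g * h + g + h)..2 * g * h + g + h}"
proof
  show "digit_values h {-g..g} \<subseteq> {-(2 * g * h + g + h)..2 * g * h + g + h}"
  proof
    fix y
    assume "y \<in> digit_values h {-g..g}"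
    then obtain a x where y: "y = (2 * h + 1) * a + x" and a: "-g \<le> a" "a \<le> g" and x: "-h \<le> x" "x \<le> h"
      unfolding digit_values_def by auto
    have "(2 * h + 1) * a \<le> (2 * h + 1) * g" "(2 * h + 1) * (-g) \<le> (2 * h + 1) * a"
      using a assms by (intro mult_left_mono; simp)+
    then show "y \<in> {-(2 * g * h + g + h)..2 * g * h + g + h}"
      using x unfolding y by (auto simp: algebra_simps)
  qed
  show "{-(2 * g * h + g + h)..2 * g * h + g + h} \<subseteq> digit_values h {-g..g}"
  proof
    fix y
    assume y: "y \<in> {-(2 * g * h + g + h)..2 * g * h + g + h}"
    define a where "a = (y + h) div (2 * h + 1)"
    define x where "x = (y + h) mod (2 * h + 1) - h"
    have "y = (2 * h + 1) * a + x"
      unfolding a_def x_def using mult_div_mod_eq[of "2 * h + 1" "y + h"] by linarith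
    moreover have x: "x \<in> {-h..h}"
      unfolding x_def using assms pos_mod_bound[of "2 * h + 1" "y + h"] by auto
    moreover have "a \<in> {-g..g}"
    proof -
      have "(2 * h + 1) * a < (2 * h + 1) * (g + 1)" "(2 * h + 1) * (-g - 1) < (2 * h + 1) * a"
        using \<open>y = (2 * h + 1) * a + x\<close> x y by (auto simp: algebra_simps)
      then have "a < g + 1" "-g - 1 < a"
        using assms by (auto simp: mult_less_cancel_left)
      then show ?thesis by auto
    qed
    ultimately show "y \<in> digit_values h {-g..g}"
      unfolding digit_values_def by force
  qed
qed

section \<open>Extending a core of columns by cancelling pairs\<close>

text \<open>A column \<open>x\<close> of the array holds the values with digits \<open>(a, \<tau> a x)\<close> for \<open>a \<in> A\<close>. Since column
  \<open>-x\<close> holds the negatives of column \<open>x\<close>, the two cancel rowwise when placed side by side; so only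
  the columns \<open>\<bar>x\<bar> \<le> p\<close> have to be arranged with care, as described by \<open>\<sigma>\<close>.\<close>

lemma zero_sum_array_from_core:
  fixes \<tau> \<sigma> :: "int \<Rightarrow> int \<Rightarrow> int"
  assumes A: "finite A" "uminus ` A = A" and p: "0 \<le> p" "p \<le> h"
    and bij: "\<And>a. a \<in> A \<Longrightarrow> bij_betw (\<tau> a) {-h..h} {-h..h}"
    and odd: "\<And>a x. a \<in> A \<Longrightarrow> \<tau> (- a) (- x) = - \<tau> a x"
    and sum: "\<And>x. x \<in> {-h..h} \<Longrightarrow> (\<Sum>a\<in>A. \<tau> a x) = 0"
    and \<sigma>: "\<And>x. x \<in> {-p..p} \<Longrightarrow> bij_betw (\<lambda>i. \<sigma> i x) A A"
    and rows: "\<And>i. i \<in> A \<Longrightarrow> (\<Sum>x\<in>{-p..p}. \<sigma> i x) = 0"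
      "\<And>i. i \<in> A \<Longrightarrow> (\<Sum>x\<in>{-p..p}. \<tau> (\<sigma> i x) x) = 0"
  shows "zero_sum_arrays (digit_values h A) 1 (card A) (nat (2 * h + 1))"
proof -
  define e where "e a x = (2 * h + 1) * a + \<tau> a x" for a x
  \<comment> \<open>\<open>U q\<close> collects the values of the columns with
    \<open>\<bar>x\<bar> \<le> q\<close>; the induction on \<open>q\<close> leads from the core
    \<open>U p\<close> to \<open>U h\<close>.\<close>
  define U where "U q = (\<lambda>(a, x). e a x) ` (A \<times> {-q..q})" for q
  have \<tau>: "\<tau> a x \<in> {-h..h}" if "a \<in> A" "x \<in> {-h..h}" for a x
    using bij[OF that(1)] that(2) by (auto simp: bij_betw_def)
  have e_eq: "a = b \<and> x = y" if "e a x = e b y" "a \<in> A" "b \<in> A" "x \<in> {-h..h}" "y \<in> {-h..h}" for a b x y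
  proof -
    have "a = b" "\<tau> a x = \<tau> b y"
      using digits_unique[of h a "\<tau> a x" b "\<tau> b y"] that \<tau> unfolding e_def by auto
    then show ?thesis
      using bij[OF that(2)] that by (auto simp: bij_betw_def inj_on_def)
  qed
  have e_neg: "e (- a) (- x) = - e a x" if "a \<in> A" for a x
    unfolding e_def odd[OF that] by simp
  have sumA: "\<Sum>A = 0"
  proof -
    have "\<Sum>A = \<Sum>(uminus ` A)" using A by simp
    also have "\<dots> = - \<Sum>A" by (subst sum.reindex) (auto simp: sum_negf)
    finally show ?thesis by simp
  qed
  have col: "(\<Sum>a\<in>A. e a x) = 0" if "x \<in> {-h..h}" for x
    unfolding e_def using sum[OF that] sumA by (simp add: sum.distrib flip: sum_distrib_left)
  have cardU: "card (U q) = card A * nat (2 * q + 1)" if "q \<le> h" for q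
  proof -
    have "inj_on (\<lambda>(a, x). e a x) (A \<times> {-q..q})"
      using that by (auto simp: inj_on_def dest!: e_eq)
    then show ?thesis
      unfolding U_def by (simp add: card_image card_cartesian_product algebra_simps)
  qed
  have main: "q \<le> h \<Longrightarrow> zero_sum_arrays (U q) 1 (card A) (nat (2 * q + 1))" if "p \<le> q" for q
    using that
  proof (induction q rule: int_ge_induct)
    case base
    show ?case
    proof (rule zero_sum_array_indexedI[where I = A and J = "{-p..p}" and g = "\<lambda>i x. e (\<sigma> i x) x"])
      show "card {-p..p} = nat (2 * p + 1)"
        by simp
      show "e (\<sigma> i x) x \<in> U p" if "i \<in> A" "x \<in> {-p..p}" for i x
        unfolding U_def using \<sigma>[OF that(2)] that by (force simp: bij_betw_def)
      show "\<exists>i\<in>A. \<exists>x\<in>{-p..p}. y = e (\<sigma> i x) x" if y: "y \<in> U p" for y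
      proof -
        obtain a x where x: "a \<in> A" "x \<in> {-p..p}" "y = e a x"
          using y unfolding U_def by auto
        then obtain i where "i \<in> A" "a = \<sigma> i x"
          using \<sigma>[of x] by (auto simp: bij_betw_def)
        then show ?thesis using x by blast
      qed
      show "(\<Sum>x\<in>{-p..p}. e (\<sigma> i x) x) = 0" if "i \<in> A" for i
        unfolding e_def using rows[OF that] by (simp add: sum.distrib flip: sum_distrib_left)
      show "(\<Sum>i\<in>A. e (\<sigma> i x) x) = 0" if "x \<in> {-p..p}" for x
        using sum.reindex_bij_betw[OF \<sigma>[OF that], of "\<lambda>a. e a x"] col[of x] that p by simp
    qed (use A cardU p in auto)
  next
    case (step q)
    \<comment> \<open>Columns \<open>q + 1\<close> and \<open>- (q + 1)\<close> form a two-row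
      array, \<open>?W\<close> and its negatives, which is transposed before being attached.\<close>
    let ?W = "(\<lambda>a. e a (q + 1)) ` A"
    have q: "q + 1 \<in> {-h..h}" "- (q + 1) \<in> {-h..h}" "q \<ge> 0"
      using step p by auto
    have inj: "inj_on (\<lambda>a. e a (q + 1)) A"
      using q by (auto simp: inj_on_def dest!: e_eq)
    have neg: "uminus ` ?W = (\<lambda>a. e a (- (q + 1))) ` A"
    proof -
      have "(\<lambda>a. e a (- (q + 1))) ` A = (\<lambda>a. e a (- (q + 1))) ` (uminus ` A)"
        using A by simp
      also have "\<dots> = uminus ` ?W"
        unfolding image_image by (intro image_cong refl) (rule e_neg)
      finally show ?thesis ..
    qed
    have "zero_sum_arrays (?W \<union> uminus ` ?W) 1 2 (card A)"
    proof (rule zero_sum_two_rows)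
      show "\<Sum>?W = 0"
        using col[OF q(1)] by (simp add: sum.reindex[OF inj])
      show "?W \<inter> uminus ` ?W = {}"
        unfolding neg using e_eq[OF _ _ _ q(1,2)] q(3) by force
    qed (use A inj in \<open>auto simp: card_image\<close>)
    then have "zero_sum_arrays (U q \<union> (?W \<union> uminus ` ?W)) 1 (card A) (nat (2 * q + 1) + 2)"
    proof (intro zero_sum_arrays_append_columns)
      show "zero_sum_arrays (U q) 1 (card A) (nat (2 * q + 1))"
        using step by simp
      have "e a x \<noteq> e b y" if "a \<in> A" "b \<in> A" "x \<in> {-q..q}" "y = q + 1 \<or> y = - (q + 1)" for a b x y
        using e_eq[of a x b y] that q step by auto
      then show "U q \<inter> (?W \<union> uminus ` ?W) = {}"
        unfolding neg U_def by auto
    qed (rule zero_sum_arrays_transpose)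
    moreover have "U q \<union> (?W \<union> uminus ` ?W) = U (q + 1)"
    proof -
      have "{-(q + 1)..q + 1} = {-q..q} \<union> {q + 1, -(q + 1)}"
        using q by auto
      then show ?thesis
        unfolding neg U_def by auto
    qed
    moreover have "nat (2 * q + 1) + 2 = nat (2 * (q + 1) + 1)"
      using q by simp
    ultimately show ?case by simp
  qed
  have "U h = digit_values h A"
  proof -
    have "U h = (\<Union>a\<in>A. (\<lambda>y. (2 * h + 1) * a + y) ` (\<tau> a ` {-h..h}))"
      unfolding U_def e_def by auto
    also have "\<dots> = (\<Union>a\<in>A. (\<lambda>y. (2 * h + 1) * a + y) ` {-h..h})"
      by (intro SUP_cong refl) (simp only: bij_betw_imp_surj_on[OF bij])
    also have "\<dots> = digit_values h A"
      by (rule set_eqI) (simp only: UN_iff image_iff mem_digit_values)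
    finally show ?thesis .
  qed
  then show ?thesis
    using main[OF p(2)] by simp
qed

section \<open>Three permutations with sum zero and the arrays with three rows\<close>

text \<open>Together with \<open>\<lambda>x. x\<close> and \<open>\<lambda>x. - kotzig h (- x)\<close>, this gives three permutations of
  \<open>{-h..h}\<close> that add up to \<open>0\<close>.\<close>

definition kotzig :: "int \<Rightarrow> int \<Rightarrow> int" where
  "kotzig h x = (if even (h - x) then (h - x) div 2 else (- h - 1 - x) div 2)"

lemma kotzig_simps:
  "kotzig h (h - 2 * t) = t" "kotzig h (h - 2 * t - 1) = t - h"
proof -
  show "kotzig h (h - 2 * t) = t"
    unfolding kotzig_def by simp
  have "(- h - 1 - (h - 2 * t - 1)) div 2 = t - h"
    by simp
  moreover have "odd (h - (h - 2 * t - 1))"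
    by simp
  ultimately show "kotzig h (h - 2 * t - 1) = t - h"
    unfolding kotzig_def by simp
qed

lemma kotzig_cases:
  fixes h x :: int
  obtains t where "x = h - 2 * t" | t where "x = h - 2 * t - 1"
  by (metis add_diff_cancel_left' diff_add_cancel diff_diff_eq2 evenE oddE diff_diff_add)

text \<open>The arguments \<open>h, h - 2, ..., -h\<close> take the values \<open>0..h\<close>, and
  \<open>h - 1, h - 3, ..., 1 - h\<close> take the values \<open>-h..-1\<close>. The sign of a value
  thus reveals the parity of the offset from \<open>h\<close>, which yields the inverse.\<close>

lemma bij_kotzig:
  assumes "h \<ge> 0"
  shows "bij_betw (kotzig h) {-h..h} {-h..h}"
proof (rule bij_betw_byWitness[where f' = "\<lambda>y. if y \<ge> 0 then h - 2 * y else - h - 1 - 2 * y"])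
  show "\<forall>x\<in>{-h..h}. (if kotzig h x \<ge> 0 then h - 2 * kotzig h x else - h - 1 - 2 * kotzig h x) = x"
  proof
    fix x
    assume "x \<in> {-h..h}"
    then show "(if kotzig h x \<ge> 0 then h - 2 * kotzig h x else - h - 1 - 2 * kotzig h x) = x"
      by (cases x h rule: kotzig_cases) (simp_all add: kotzig_simps)
  qed
  show "kotzig h ` {-h..h} \<subseteq> {-h..h}"
  proof (rule image_subsetI)
    fix x
    assume "x \<in> {-h..h}"
    then show "kotzig h x \<in> {-h..h}"
      by (cases x h rule: kotzig_cases) (simp_all add: kotzig_simps)
  qed
  show "\<forall>y\<in>{-h..h}. kotzig h (if y \<ge> 0 then h - 2 * y else - h - 1 - 2 * y) = y"
  proof
    fix y
    have "- h - 1 - 2 * y = h - 2 * (h + y) - 1"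
      by simp
    then have "kotzig h (- h - 1 - 2 * y) = y"
      by (simp only: kotzig_simps)
    then show "kotzig h (if y \<ge> 0 then h - 2 * y else - h - 1 - 2 * y) = y"
      by (simp add: kotzig_simps)
  qed
qed (use assms in auto)

text \<open>Negating \<open>x\<close> preserves the parity of \<open>h - x\<close>: the parameter
  \<open>t\<close> becomes \<open>h - t\<close> in the even case and \<open>h - t - 1\<close> in the
  odd case.\<close>

lemma kotzig_sum: "x + kotzig h x - kotzig h (- x) = 0"
proof (cases x h rule: kotzig_cases)
  case (1 t)
  then have "- x = h - 2 * (h - t)" by simp
  then have "kotzig h (- x) = h - t" by (simp only: kotzig_simps)
  then show ?thesis using 1 by (simp add: kotzig_simps)
next
  case (2 t)
  then have "- x = h - 2 * (h - t - 1) - 1" by simp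
  then have "kotzig h (- x) = (h - t - 1) - h" by (simp only: kotzig_simps)
  then show ?thesis using 2 by (simp add: kotzig_simps)
qed

lemma bij_uminus_symmetric: "bij_betw (\<lambda>x. - x) {-h..h} {-h..h::int}"
  by (rule bij_betw_byWitness[where f' = uminus]) auto

text \<open>Conjugation by negation makes the permutations for the digits \<open>1\<close> and
  \<open>-1\<close> mirror each other, as \<open>zero_sum_array_from_core\<close> demands of
  \<open>\<tau>\<close>.\<close>

definition kotzig_neg :: "int \<Rightarrow> int \<Rightarrow> int" where
  "kotzig_neg h x = - kotzig h (- x)"

lemma bij_kotzig_neg:
  assumes "h \<ge> 0"
  shows "bij_betw (kotzig_neg h) {-h..h} {-h..h}"
proof -
  have "kotzig_neg h = uminus \<circ> (kotzig h \<circ> uminus)"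
    by (auto simp: kotzig_neg_def)
  then show ?thesis
    using bij_betw_trans[OF bij_betw_trans[OF bij_uminus_symmetric bij_kotzig[OF assms]]
        bij_uminus_symmetric] by simp
qed

lemma zero_sum_array_three:
  assumes "h \<ge> 3"
  shows "zero_sum_arrays (digit_values h {-1..1}) 1 3 (nat (2 * h + 1))"
proof -
  define \<tau> where "\<tau> a = (if a = 1 then kotzig h else if a = -1 then kotzig_neg h else (\<lambda>x. x))" for a :: int
  \<comment> \<open>Row \<open>i\<close> has leading digit \<open>\<sigma> i x\<close> in column
    \<open>x\<close>. The core consists of the columns from \<open>-3\<close> to \<open>3\<close>,
    whence \<open>h \<ge> 3\<close>.\<close>
  define \<sigma> :: "int \<Rightarrow> int \<Rightarrow> int" where "\<sigma> i x =
    (if i = 1 then (if x \<in> {0, -1} then 1 else if x \<in> {-2, 3} then -1 else 0)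
     else if i = -1 then (if x \<in> {1, 2} then 1 else if x \<in> {0, -3} then -1 else 0)
     else (if x \<in> {-3, -2, 3} then 1 else if x \<in> {-1, 1, 2} then -1 else 0))" for i x
  have A: "{-1..1} = {-1, 0, 1::int}" by auto
  have X: "{-3..3} = {-3, -2, -1, 0, 1, 2, 3::int}" by auto
  have "zero_sum_arrays (digit_values h {-1..1}) 1 (card {-1..1::int}) (nat (2 * h + 1))"
  proof (rule zero_sum_array_from_core[where \<tau> = \<tau> and \<sigma> = \<sigma> and p = 3])
    show "uminus ` {-1..1} = {-1..1::int}" by auto
    show "bij_betw (\<tau> a) {-h..h} {-h..h}" for a
      using assms bij_kotzig bij_kotzig_neg bij_betw_id[unfolded id_def] by (auto simp: \<tau>_def)
    show "\<tau> (- a) (- x) = - \<tau> a x" for a x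
      unfolding \<tau>_def kotzig_neg_def by auto
    show "(\<Sum>a\<in>{-1..1}. \<tau> a x) = 0" for x
      unfolding A \<tau>_def kotzig_neg_def using kotzig_sum[of x h] by simp
    show "bij_betw (\<lambda>i. \<sigma> i x) {-1..1} {-1..1}" if "x \<in> {-3..3}" for x
      using that unfolding A X by (auto simp: \<sigma>_def bij_betw_def inj_on_def)
    show "(\<Sum>x\<in>{-3..3}. \<sigma> i x) = 0" if "i \<in> {-1..1}" for i
      using that unfolding A X by (auto simp: \<sigma>_def)
    show "(\<Sum>x\<in>{-3..3}. \<tau> (\<sigma> i x) x) = 0" if "i \<in> {-1..1}" for i
    proof -
      \<comment> \<open>The parity of \<open>h\<close> decides the branches of
        \<open>kotzig\<close>. The rows balance because
        \<open>kotzig h (x + 2) = kotzig h x - 1\<close>; row \<open>1\<close>, for instance, leaves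
        \<open>kotzig h 0 - kotzig h 2 + kotzig h (-1) - kotzig h (-3) = 1 - 1\<close>.\<close>
      consider t where "h = 2 * t" | t where "h = 2 * t + 1"
        by (metis evenE oddE)
      then show ?thesis
        using that unfolding A X
        by cases (auto simp: \<sigma>_def \<tau>_def kotzig_def kotzig_neg_def)
    qed
  qed (use assms in auto)
  then show ?thesis by simp
qed

section \<open>Strips of four and of two rows\<close>

text \<open>The sets \<open>{l..u} \<union> {-u..-l}\<close> serve to adjust the size of a set without changing its sum.\<close>

lemma symmetric_set:
  fixes l u :: int
  assumes "l \<ge> 1" "u \<ge> l - 1"
  shows "finite ({l..u} \<union> {-u..-l})" "\<Sum>({l..u} \<union> {-u..-l}) = 0"
    "int (card ({l..u} \<union> {-u..-l})) = 2 * (u - l + 1)"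
proof -
  have eq: "{-u..-l} = uminus ` {l..u}" by simp
  have "\<Sum>{-u..-l} = - \<Sum>{l..u}"
    unfolding eq by (subst sum.reindex) (auto simp: sum_negf)
  moreover have disj: "{l..u} \<inter> {-u..-l} = {}"
    using assms by auto
  ultimately show "\<Sum>({l..u} \<union> {-u..-l}) = 0"
    by (simp add: sum.union_disjoint)
  show "int (card ({l..u} \<union> {-u..-l})) = 2 * (u - l + 1)"
    using disj assms by (simp add: card_Un_disjoint)
qed simp

text \<open>For even \<open>s\<close>, pairs \<open>\<plusminus>2, \<plusminus>3, ...\<close>
  suffice; for odd \<open>s\<close>, the triple \<open>1, 2, -3\<close> is completed by pairs from
  \<open>\<plusminus>4\<close> on. The values \<open>0\<close> and \<open>-1\<close> stay free
  because the strip of four rows treats these two columns separately.\<close>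

lemma zero_sum_subset:
  fixes a s :: int
  assumes "2 \<le> a" "2 \<le> s" "s \<le> a + 1"
  obtains Y where "Y \<subseteq> {-(a + 1)..a + 1} - {0, -1}" "\<Sum>Y = 0" "int (card Y) = s"
proof (cases "even s")
  case True
  then obtain k where k: "s = 2 * k" by blast
  let ?S = "{2..k + 1} \<union> {-(k + 1)..-2}"
  have "?S \<subseteq> {-(a + 1)..a + 1} - {0, -1}"
    using k assms by auto
  moreover have "\<Sum>?S = 0" "int (card ?S) = s"
    using symmetric_set[of 2 "k + 1"] k assms by auto
  ultimately show ?thesis by (rule that)
next
  case False
  then obtain k where k: "s = 2 * k + 1" by (metis oddE)
  let ?S = "{4..k + 2} \<union> {-(k + 2)..-4}"
  have S: "finite ?S" "\<Sum>?S = 0" "int (card ?S) = s - 3"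
    using symmetric_set[of 4 "k + 2"] k assms by auto
  have "{1, 2, -3} \<inter> ?S = {}" by auto
  then have "\<Sum>({1, 2, -3} \<union> ?S) = \<Sum>{1, 2, -3} + \<Sum>?S"
    "card ({1, 2, -3} \<union> ?S) = card {1, 2, -3::int} + card ?S"
    using S(1) by (intro sum.union_disjoint card_Un_disjoint; simp)+
  then have "\<Sum>({1, 2, -3} \<union> ?S) = 0" "int (card ({1, 2, -3} \<union> ?S)) = s"
    using S(2,3) by simp_all
  moreover have "{1, 2, -3} \<union> ?S \<subseteq> {-(a + 1)..a + 1} - {0, -1}"
    using k assms by auto
  ultimately show ?thesis using that by blast
qed

text \<open>In a row of odd length whose leading digits sum to \<open>0\<close>, the digits \<open>\<plusminus>a\<close> have net count \<open>t (a + 1)\<close>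
  and the digits \<open>\<plusminus>(a + 1)\<close> have net count \<open>- t a\<close> with \<open>t\<close> odd. This needs a core of more than
  \<open>2 a\<close> columns, whence the hypothesis on \<open>h\<close>.\<close>

lemma zero_sum_array_strip:
  assumes "2 \<le> a" "a + 1 \<le> h"
  shows "zero_sum_arrays (digit_values h {a, -a, a + 1, -(a + 1)}) 1 4 (nat (2 * h + 1))"
proof -
  define b where "b = a + 1"
  let ?A = "{a, -a, b, -b}"
  let ?D = "{-b..b} - {0, -1}"
  obtain Y where Y: "Y \<subseteq> ?D" "\<Sum>Y = 0" "int (card Y) = a"
    using zero_sum_subset[of a a] assms unfolding b_def by auto
  obtain Z where Z: "Z \<subseteq> ?D" "\<Sum>Z = 0" "int (card Z) = b"
    using zero_sum_subset[of a b] assms unfolding b_def by auto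
  \<comment> \<open>Digits \<open>\<plusminus>a\<close> carry \<open>x\<close> and digits
    \<open>\<plusminus>b\<close> carry \<open>-x\<close>, so the four last digits of a column
    cancel.\<close>
  define \<tau> where "\<tau> c = (if \<bar>c\<bar> = a then (\<lambda>x::int. x) else uminus)" for c :: int
  \<comment> \<open>In a generic column, rows \<open>a\<close> and \<open>b\<close> share the digits
    \<open>a\<close> and \<open>-b\<close> according to \<open>Y\<close>, and rows \<open>-a\<close>
    and \<open>-b\<close> share \<open>-a\<close> and \<open>b\<close> according to
    \<open>Z\<close>. Over these columns, rows \<open>b\<close> and \<open>-b\<close> have digit
    sums \<open>-(a + b)\<close> and \<open>a + b\<close>, the other two have \<open>0\<close>;
    columns \<open>0\<close> and \<open>-1\<close> compensate for this.\<close>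
  define \<sigma> where "\<sigma> i x =
    (if i = a then (if x = 0 then -a else if x = -1 then a else if x \<in> Y then -b else a)
     else if i = b then (if x = 0 then a else if x = -1 then b else if x \<in> Y then a else -b)
     else if i = -a then (if x = 0 then b else if x = -1 then -b else if x \<in> Z then -a else b)
     else (if x = 0 then -b else if x = -1 then -a else if x \<in> Z then b else -a))" for i x
  have pos: "a > 0" "b > 0"
    using assms unfolding b_def by auto
  have ne: "a \<noteq> b" "-a \<noteq> b" "-b \<noteq> a" "a \<noteq> -b" "b \<noteq> -a" "a \<noteq> -a" "b \<noteq> -b"
    "\<bar>a\<bar> = a" "\<bar>b\<bar> = b"
    using assms unfolding b_def by auto
  have \<sigma>: "\<sigma> a x = (if x = 0 then -a else if x = -1 then a else if x \<in> Y then -b else a)"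
    "\<sigma> b x = (if x = 0 then a else if x = -1 then b else if x \<in> Y then a else -b)"
    "\<sigma> (-a) x = (if x = 0 then b else if x = -1 then -b else if x \<in> Z then -a else b)"
    "\<sigma> (-b) x = (if x = 0 then -b else if x = -1 then -a else if x \<in> Z then b else -a)" for x
    using ne by (simp_all add: \<sigma>_def)
  have \<tau>: "\<tau> a x = x" "\<tau> (-a) x = x" "\<tau> b x = - x" "\<tau> (-b) x = - x" for x
    using ne by (simp_all add: \<tau>_def)
  have Y0: "x \<noteq> 0" "x \<noteq> -1" if "x \<in> Y" for x
    using that Y(1) by auto
  have Z0: "x \<noteq> 0" "x \<noteq> -1" if "x \<in> Z" for x
    using that Z(1) by auto
  \<comment> \<open>Omitting \<open>0\<close> and \<open>-1\<close> leaves the sum \<open>1\<close>;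
    in each row, the last digit \<open>\<plusminus>1\<close> of column \<open>-1\<close> offsets
    it.\<close>
  have D: "finite ?D" "\<Sum>?D = 1" "int (card ?D) = 2 * a + 1"
  proof -
    have "{-b..b} = insert 0 ({1..b} \<union> {-b..-1})"
      using pos by auto
    then have "\<Sum>{-b..b} = 0"
      using symmetric_set(2)[of 1 b] pos by simp
    then show "\<Sum>?D = 1"
      using pos by (subst sum_diff) auto
    show "int (card ?D) = 2 * a + 1"
      using pos by (subst card_Diff_subset) (auto simp: b_def)
  qed simp
  have split: "(\<Sum>x\<in>{-b..b}. f x) = f 0 + f (-1) + ((\<Sum>x\<in>S. f x) + (\<Sum>x\<in>?D - S. f x))"
    if "S \<subseteq> ?D" for f :: "int \<Rightarrow> int" and S
  proof -
    have "(\<Sum>x\<in>{-b..b}. f x) = (\<Sum>x\<in>?D. f x) + (\<Sum>x\<in>{0, -1}. f x)"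
      using pos by (intro sum.subset_diff) auto
    moreover have "(\<Sum>x\<in>?D. f x) = (\<Sum>x\<in>?D - S. f x) + (\<Sum>x\<in>S. f x)"
      by (rule sum.subset_diff[OF that D(1)])
    ultimately show ?thesis by simp
  qed
  have compl: "\<Sum>(?D - S) = 1 - \<Sum>S" "int (card (?D - S)) = 2 * a + 1 - int (card S)" if "S \<subseteq> ?D" for S
  proof -
    show "\<Sum>(?D - S) = 1 - \<Sum>S"
      using sum.subset_diff[OF that D(1), of "\<lambda>x. x"] D(2) by linarith
    have "card (?D - S) = card ?D - card S" "card S \<le> card ?D"
      by (rule card_Diff_subset[OF finite_subset[OF that D(1)] that], rule card_mono[OF D(1) that])
    then show "int (card (?D - S)) = 2 * a + 1 - int (card S)"
      using D(3) by linarith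
  qed
  \<comment> \<open>Entries are affine in \<open>x\<close> on \<open>S\<close> and on its
    complement. As \<open>S\<close> has sum \<open>0\<close> and the complement sum
    \<open>1\<close>, the slope \<open>\<gamma>\<close> drops out and \<open>\<delta>\<close>
    survives once.\<close>
  have row: "(\<Sum>x\<in>{-b..b}. f x) = f 0 + f (-1) + \<alpha> * int (card S) + \<beta> * (2 * a + 1 - int (card S)) + \<delta>"
    if "S \<subseteq> ?D" "\<Sum>S = 0" "\<And>x. x \<in> S \<Longrightarrow> f x = \<alpha> + \<gamma> * x" "\<And>x. x \<in> ?D - S \<Longrightarrow> f x = \<beta> + \<delta> * x"
    for f :: "int \<Rightarrow> int" and S \<alpha> \<beta> \<gamma> \<delta>
  proof -
    have "(\<Sum>x\<in>S. f x) = (\<Sum>x\<in>S. \<alpha> + \<gamma> * x)"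
      by (intro sum.cong refl that(3))
    also have "\<dots> = \<alpha> * int (card S) + \<gamma> * \<Sum>S"
      by (simp add: sum.distrib sum_distrib_left mult.commute)
    finally have S: "(\<Sum>x\<in>S. f x) = \<alpha> * int (card S)"
      using that(2) by simp
    have "(\<Sum>x\<in>?D - S. f x) = (\<Sum>x\<in>?D - S. \<beta> + \<delta> * x)"
      by (intro sum.cong refl that(4))
    also have "\<dots> = int (card (?D - S)) * \<beta> + \<delta> * \<Sum>(?D - S)"
      by (simp only: sum.distrib sum_distrib_left sum_constant of_nat_id)
    finally have "(\<Sum>x\<in>?D - S. f x) = \<beta> * (2 * a + 1 - int (card S)) + \<delta>"
      using that(2) unfolding compl[OF that(1)] by simp
    then show ?thesis
      unfolding split[OF that(1)] S by simp
  qed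
  have "zero_sum_arrays (digit_values h ?A) 1 (card ?A) (nat (2 * h + 1))"
  proof (rule zero_sum_array_from_core[where \<tau> = \<tau> and \<sigma> = \<sigma> and p = b])
    show "bij_betw (\<tau> c) {-h..h} {-h..h}" for c
      using bij_uminus_symmetric[of h] bij_betw_id[unfolded id_def] by (auto simp: \<tau>_def)
    show "(\<Sum>c\<in>?A. \<tau> c x) = 0" for x
      using ne by (simp add: \<tau>_def)
    show "bij_betw (\<lambda>i. \<sigma> i x) ?A ?A" if "x \<in> {-b..b}" for x
    proof -
      have surj: "(\<lambda>i. \<sigma> i x) ` ?A = ?A"
        by (cases "x \<in> Y"; cases "x \<in> Z"; cases "x = 0"; cases "x = -1") (simp_all add: \<sigma> insert_commute)
      show ?thesis
        unfolding bij_betw_def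
        by (intro conjI surj eq_card_imp_inj_on) (simp, simp only: surj)
    qed
    show "uminus ` ?A = ?A"
      by auto
    show "\<tau> (- c) (- x) = - \<tau> c x" for c x
      by (simp add: \<tau>_def)
    show "0 \<le> b" "b \<le> h"
      using pos assms unfolding b_def by auto
    fix i
    assume "i \<in> ?A"
    then consider "i = a" | "i = b" | "i = -a" | "i = -b" by auto
    note cases = this
    show "(\<Sum>x\<in>{-b..b}. \<sigma> i x) = 0"
      using cases
    proof cases
      case 1
      have "(\<Sum>x\<in>{-b..b}. \<sigma> i x) = -a + a + (-b) * int (card Y) + a * (2 * a + 1 - int (card Y)) + 0"
        using row[OF Y(1,2), of "\<lambda>x. \<sigma> i x" "(-b)" "0" "a" "0"] by (simp add: 1 \<sigma> \<tau> Y0)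
      also have "\<dots> = 0"
        unfolding Y(3) unfolding b_def by algebra
      finally show ?thesis .
    next
      case 2
      have "(\<Sum>x\<in>{-b..b}. \<sigma> i x) = a + b + a * int (card Y) + (-b) * (2 * a + 1 - int (card Y)) + 0"
        using row[OF Y(1,2), of "\<lambda>x. \<sigma> i x" "a" "0" "(-b)" "0"] by (simp add: 2 \<sigma> \<tau> Y0)
      also have "\<dots> = 0"
        unfolding Y(3) unfolding b_def by algebra
      finally show ?thesis .
    next
      case 3
      have "(\<Sum>x\<in>{-b..b}. \<sigma> i x) = b + (-b) + (-a) * int (card Z) + b * (2 * a + 1 - int (card Z)) + 0"
        using row[OF Z(1,2), of "\<lambda>x. \<sigma> i x" "(-a)" "0" "b" "0"] by (simp add: 3 \<sigma> \<tau> Z0)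
      also have "\<dots> = 0"
        unfolding Z(3) unfolding b_def by algebra
      finally show ?thesis .
    next
      case 4
      have "(\<Sum>x\<in>{-b..b}. \<sigma> i x) = -b + (-a) + b * int (card Z) + (-a) * (2 * a + 1 - int (card Z)) + 0"
        using row[OF Z(1,2), of "\<lambda>x. \<sigma> i x" "b" "0" "(-a)" "0"] by (simp add: 4 \<sigma> \<tau> Z0)
      also have "\<dots> = 0"
        unfolding Z(3) unfolding b_def by algebra
      finally show ?thesis .
    qed
    show "(\<Sum>x\<in>{-b..b}. \<tau> (\<sigma> i x) x) = 0"
      using cases
    proof cases
      case 1
      have "(\<Sum>x\<in>{-b..b}. \<tau> (\<sigma> i x) x) = 0 + (-1) + 0 * int (card Y) + 0 * (2 * a + 1 - int (card Y)) + 1"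
        using row[OF Y(1,2), of "\<lambda>x. \<tau> (\<sigma> i x) x" "0" "(-1)" "0" "1"] by (simp add: 1 \<sigma> \<tau> Y0)
      also have "\<dots> = 0"
        unfolding Y(3) unfolding b_def by algebra
      finally show ?thesis .
    next
      case 2
      have "(\<Sum>x\<in>{-b..b}. \<tau> (\<sigma> i x) x) = 0 + 1 + 0 * int (card Y) + 0 * (2 * a + 1 - int (card Y)) + (-1)"
        using row[OF Y(1,2), of "\<lambda>x. \<tau> (\<sigma> i x) x" "0" "1" "0" "(-1)"] by (simp add: 2 \<sigma> \<tau> Y0)
      also have "\<dots> = 0"
        unfolding Y(3) unfolding b_def by algebra
      finally show ?thesis .
    next
      case 3
      have "(\<Sum>x\<in>{-b..b}. \<tau> (\<sigma> i x) x) = 0 + 1 + 0 * int (card Z) + 0 * (2 * a + 1 - int (card Z)) + (-1)"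
        using row[OF Z(1,2), of "\<lambda>x. \<tau> (\<sigma> i x) x" "0" "1" "0" "(-1)"] by (simp add: 3 \<sigma> \<tau> Z0)
      also have "\<dots> = 0"
        unfolding Z(3) unfolding b_def by algebra
      finally show ?thesis .
    next
      case 4
      have "(\<Sum>x\<in>{-b..b}. \<tau> (\<sigma> i x) x) = 0 + (-1) + 0 * int (card Z) + 0 * (2 * a + 1 - int (card Z)) + 1"
        using row[OF Z(1,2), of "\<lambda>x. \<tau> (\<sigma> i x) x" "0" "(-1)" "0" "1"] by (simp add: 4 \<sigma> \<tau> Z0)
      also have "\<dots> = 0"
        unfolding Z(3) unfolding b_def by algebra
      finally show ?thesis .
    qed
  qed simp
  moreover have "card ?A = 4"
    using ne by simp
  ultimately show ?thesis
    unfolding b_def by simp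
qed

text \<open>Let \<open>N = 2 * h + 1\<close>. One row has leading digit \<open>-2\<close> in the
  \<open>h\<close> columns of \<open>Q\<close>, with last digits negated, and \<open>2\<close> in
  the other \<open>h + 1\<close> columns. The leading digits contribute \<open>2 * N\<close>, and
  the last digits \<open>-2 * N\<close> if \<open>Q\<close> has sum \<open>N\<close> and hence its
  complement sum \<open>-N\<close>.\<close>

lemma zero_sum_array_two:
  assumes "h \<ge> 4"
  shows "zero_sum_arrays (digit_values h {2, -2}) 1 2 (nat (2 * h + 1))"
proof -
  define N where "N = 2 * h + 1"
  obtain Q where Q: "Q \<subseteq> {-h..h}" "\<Sum>Q = N" "int (card Q) = h"
  proof -
    \<comment> \<open>\<open>T\<close> has sum \<open>2 * h + 1\<close>; the pairs
      \<open>\<plusminus>3, ..., \<plusminus>u\<close> raise the size to \<open>h\<close>, and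
      \<open>u \<le> h - 2\<close> keeps them away from \<open>T\<close>.\<close>
    define u where "u = (if even h then h div 2 else (h + 1) div 2)"
    define T where "T = (if even h then {0, 2, h - 1, h} else {2, h - 1, h})"
    let ?S = "{3..u} \<union> {-u..-3}"
    have u: "2 \<le> u" "u \<le> h - 2" "2 * u = (if even h then h else h + 1)"
      using assms unfolding u_def by (auto elim!: evenE oddE)
    have S: "finite ?S" "\<Sum>?S = 0" "int (card ?S) = 2 * (u - 2)"
      using symmetric_set[of 3 u] u by auto
    have T: "finite T" "\<Sum>T = N" "int (card T) = (if even h then 4 else 3)"
      using assms unfolding T_def N_def by auto
    have "T \<inter> ?S = {}"
      using u assms unfolding T_def by auto
    then have "\<Sum>(T \<union> ?S) = \<Sum>T + \<Sum>?S" "card (T \<union> ?S) = card T + card ?S"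
      using S(1) T(1) by (intro sum.union_disjoint card_Un_disjoint; simp)+
    then have "\<Sum>(T \<union> ?S) = N" "int (card (T \<union> ?S)) = h"
      using S T u(3) by (auto split: if_splits)
    moreover have "T \<union> ?S \<subseteq> {-h..h}"
      using u assms unfolding T_def by auto
    ultimately show ?thesis using that by blast
  qed
  let ?P = "{-h..h} - Q"
  have fin: "finite Q" "finite ?P"
    using Q(1) finite_subset by auto
  have "{-h..h} = insert 0 ({1..h} \<union> {-h..-1})"
    using assms by auto
  then have "\<Sum>{-h..h} = 0"
    using symmetric_set(2)[of 1 h] assms by simp
  moreover have "\<Sum>{-h..h} = \<Sum>?P + \<Sum>Q"
    by (rule sum.subset_diff[OF Q(1)]) simp
  ultimately have "\<Sum>?P = - N"
    using Q(2) by linarith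
  moreover have "int (card ?P) = h + 1"
  proof -
    have "card ?P = card {-h..h} - card Q" "card Q \<le> card {-h..h}" "int (card {-h..h}) = 2 * h + 1"
      using fin(1) Q(1) assms card_mono[of "{-h..h}" Q] by (simp_all add: card_Diff_subset)
    then show ?thesis
      using Q(3) by linarith
  qed
  ultimately have P: "\<Sum>?P = - N" "int (card ?P) = h + 1"
    by blast+
  let ?p = "\<lambda>x. N * 2 + x" and ?q = "\<lambda>x. N * (-2) - x"
  let ?W = "?p ` ?P \<union> ?q ` Q"
  have W: "\<Sum>(?p ` ?P) = (2 * h + 2) * N - N" "\<Sum>(?q ` Q) = - (2 * h) * N - N"
    "int (card (?p ` ?P)) = h + 1" "int (card (?q ` Q)) = h"
  proof -
    have "inj_on ?p ?P" "inj_on ?q Q" by (auto simp: inj_on_def)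
    then show "\<Sum>(?p ` ?P) = (2 * h + 2) * N - N" "\<Sum>(?q ` Q) = - (2 * h) * N - N"
      "int (card (?p ` ?P)) = h + 1" "int (card (?q ` Q)) = h"
      using P Q by (simp_all add: sum.reindex card_image sum.distrib sum_subtractf algebra_simps)
  qed
  have pos: "?p x > 0" "?q x < 0" if "x \<in> {-h..h}" for x
    using that unfolding N_def by auto
  have pq: "?p ` S \<inter> ?q ` S' = {}" if S: "S \<subseteq> {-h..h}" "S' \<subseteq> {-h..h}" for S S'
  proof (rule equals0I)
    fix z
    assume "z \<in> ?p ` S \<inter> ?q ` S'"
    then obtain x y where xy: "x \<in> S" "y \<in> S'" "z = ?p x" "z = ?q y"
      by (elim IntE imageE)
    have "x \<in> {-h..h}" "y \<in> {-h..h}"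
      using S xy(1,2) by auto
    from pos(1)[OF this(1)] pos(2)[OF this(2)] show False
      unfolding xy(3)[symmetric] xy(4)[symmetric] by simp
  qed
  have disj: "?p ` ?P \<inter> ?q ` Q = {}"
    using Q(1) by (intro pq) auto
  have neg: "uminus ` ?W = ?q ` ?P \<union> ?p ` Q"
    by (auto simp: image_Un image_image)
  have "zero_sum_arrays (?W \<union> uminus ` ?W) 1 2 (nat N)"
  proof (rule zero_sum_two_rows)
    show "\<Sum>?W = 0"
      using W fin disj by (simp add: sum.union_disjoint N_def algebra_simps)
    show "card ?W = nat N"
      using W fin disj by (simp add: card_Un_disjoint N_def)
    have P: "?P \<subseteq> {-h..h}" and PQ: "?P \<inter> Q = {}"
      by blast+
    have "?p ` ?P \<inter> ?p ` Q = {}" "?q ` Q \<inter> ?q ` ?P = {}"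
      using PQ by (subst image_Int[symmetric]; force simp: inj_on_def)+
    moreover have "?p ` ?P \<inter> ?q ` ?P = {}" "?q ` Q \<inter> ?p ` Q = {}"
      using pq[OF P P] pq[OF Q(1) Q(1)] by (simp_all only: Int_commute)
    ultimately show "?W \<inter> uminus ` ?W = {}"
      unfolding neg Int_Un_distrib Int_Un_distrib2 by (simp only: Un_empty_left)
  qed (use fin in auto)
  moreover have "?W \<union> uminus ` ?W = digit_values h {2, -2}"
  proof -
    have "digit_values h {2, -2} = ?p ` {-h..h} \<union> (\<lambda>x. N * (-2) + x) ` {-h..h}"
      by (rule set_eqI) (simp only: Un_iff image_iff mem_digit_values N_def bex_simps simp_thms)
    also have "(\<lambda>x. N * (-2) + x) ` {-h..h} = (\<lambda>x. N * (-2) + x) ` uminus ` {-h..h}"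
      by simp
    also have "\<dots> = ?q ` {-h..h}"
      unfolding image_image by simp
    finally show ?thesis
      unfolding neg using Q(1) by blast
  qed
  ultimately show ?thesis
    unfolding N_def by simp
qed

section \<open>Two explicit arrays and the induction on the number of rows\<close>

lemma zero_sum_array_list:
  fixes L :: "int list list"
  assumes "set (concat L) = V" "length L = m" "card V = m * n"
    and "\<forall>row\<in>set L. length row = n \<and> sum_list row = 0"
    and "\<forall>j<n. sum_list (map (\<lambda>row. row ! j) L) = 0"
  shows "zero_sum_arrays V 1 m n"
proof (rule zero_sum_array_indexedI[where I = "{..<length L}" and J = "{..<n}" and g = "\<lambda>i j. L ! i ! j"])
  show "L ! i ! j \<in> V" if "i \<in> {..<length L}" "j \<in> {..<n}" for i j
    using that assms(1,4) nth_mem[of i L] nth_mem[of j "L ! i"] by (auto intro!: bexI[of _ "L ! i"])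
  show "\<exists>i\<in>{..<length L}. \<exists>j\<in>{..<n}. x = L ! i ! j" if x: "x \<in> V" for x
  proof -
    obtain row where "row \<in> set L" "x \<in> set row"
      using x assms(1) by auto
    then show ?thesis
      using assms(4) by (metis in_set_conv_nth lessThan_iff)
  qed
  show "(\<Sum>j\<in>{..<n}. L ! i ! j) = 0" if "i \<in> {..<length L}" for i
  proof -
    have "length (L ! i) = n" "sum_list (L ! i) = 0"
      using that assms(4) by auto
    then show ?thesis
      by (simp add: sum_list_sum_nth atLeast0LessThan)
  qed
  show "(\<Sum>i\<in>{..<length L}. L ! i ! j) = 0" if "j \<in> {..<n}" for j
    using that assms(5) by (simp add: sum_list_sum_nth atLeast0LessThan)
qed (use assms(2,3) in auto)

text \<open>Here \<open>h = 2\<close>, too small for the seven-column core of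
  \<open>zero_sum_array_three\<close>.\<close>

lemma zero_sum_array_3_5: "zero_sum_arrays {-7..7} 1 3 5"
proof -
  let ?L = "[[-7, 7, 0, -1, 1], [5, -4, 6, -2, -5], [2, -3, -6, 3, 4]] :: int list list"
  have "set (concat ?L) = {-7..7}"
    by code_simp
  moreover have "\<forall>j<5. sum_list (map (\<lambda>row. row ! j) ?L) = 0"
    by code_simp
  ultimately show ?thesis
    using zero_sum_array_list[of ?L "{-7..7}" 3 5] by simp
qed

text \<open>Here \<open>h = 3\<close>, and no three distinct elements of \<open>{-3..3}\<close> add
  up to \<open>7\<close>, so \<open>zero_sum_array_two\<close> would have no suitable
  \<open>Q\<close>.\<close>

lemma zero_sum_array_5_7: "zero_sum_arrays {-17..17} 1 5 7"
proof -
  let ?L = "[[-1, 6, 3, -10, 14, -7, -5], [-4, -12, 17, 10, 4, -9, -6], [9, -13, 5, -3, -14, 16, 0],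
    [-16, 11, -17, 2, 7, 15, -2], [12, 8, -8, 1, -11, -15, 13]] :: int list list"
  have "set (concat ?L) = {-17..17}"
    by code_simp
  moreover have "\<forall>j<7. sum_list (map (\<lambda>row. row ! j) ?L) = 0"
    by code_simp
  ultimately show ?thesis
    using zero_sum_array_list[of ?L "{-17..17}" 5 7] by simp
qed

text \<open>A strip of four rows with leading digits
  \<open>\<plusminus>(g - 1), \<plusminus>g\<close> passes from \<open>g - 2\<close> to
  \<open>g\<close>, so the cases \<open>g = 1\<close> and \<open>g = 2\<close> start the
  induction.\<close>

lemma zero_sum_array_odd_lt:
  fixes g h :: int
  assumes "1 \<le> g" "g < h"
  shows "zero_sum_arrays (digit_values h {-g..g}) 1 (nat (2 * g + 1)) (nat (2 * h + 1))"
  using assms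
proof (induction "nat g" arbitrary: g rule: less_induct)
  case less
  consider "g = 1" "h = 2" | "g = 1" "h \<ge> 3" | "g = 2" "h = 3" | "g = 2" "h \<ge> 4" | "g \<ge> 3"
    using less.prems by linarith
  then show ?case
  proof cases
    case 1
    then show ?thesis
      using zero_sum_array_3_5 by (simp add: digit_values_interval)
  next
    case 2
    then show ?thesis
      using zero_sum_array_three by simp
  next
    case 3
    then show ?thesis
      using zero_sum_array_5_7 by (simp add: digit_values_interval)
  next
    case 4
    have "zero_sum_arrays (digit_values h {-1..1} \<union> digit_values h {2, -2}) 1 (3 + 2) (nat (2 * h + 1))"
      using 4 by (intro zero_sum_arrays_append_rows zero_sum_array_three zero_sum_array_two digit_values_disjoint) auto
    moreover have "{-1..1} \<union> {2, -2} = {-2..2::int}"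
      by auto
    ultimately show ?thesis
      using 4 by (simp flip: digit_values_Un)
  next
    case 5
    define a where "a = g - 1"
    have "zero_sum_arrays (digit_values h {-(a - 1)..a - 1} \<union> digit_values h {a, -a, a + 1, -(a + 1)})
      1 (nat (2 * (a - 1) + 1) + 4) (nat (2 * h + 1))"
    proof (intro zero_sum_arrays_append_rows zero_sum_array_strip digit_values_disjoint)
      show "zero_sum_arrays (digit_values h {-(a - 1)..a - 1}) 1 (nat (2 * (a - 1) + 1)) (nat (2 * h + 1))"
        using 5 less.prems by (intro less.hyps) (auto simp: a_def)
    qed (use 5 less.prems in \<open>auto simp: a_def\<close>)
    moreover have "{-(a - 1)..a - 1} \<union> {a, -a, a + 1, -(a + 1)} = {-g..g}"
      using 5 unfolding a_def by auto
    moreover have "nat (2 * (a - 1) + 1) + 4 = nat (2 * g + 1)"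
      using 5 unfolding a_def by simp
    ultimately show ?thesis
      by (simp flip: digit_values_Un)
  qed
qed

lemma zero_sum_array_odd_single:
  assumes "odd m" "odd n" "m > 1" "n > 1" "m \<noteq> n"
  shows "zero_sum_arrays {-((int (m * n) - 1) div 2)..(int (m * n) - 1) div 2} 1 m n"
proof -
  have lt: "zero_sum_arrays {-((int (m * n) - 1) div 2)..(int (m * n) - 1) div 2} 1 m n"
    if mn: "odd m" "odd n" "m > 1" "m < n" for m n :: nat
  proof -
    obtain g h where g: "m = 2 * g + 1" "n = 2 * h + 1"
      using mn by (metis oddE)
    have half: "(int (m * n) - 1) div 2 = 2 * int g * int h + int g + int h"
    proof -
      have "int (m * n) - 1 = 2 * (2 * int g * int h + int g + int h)"
        unfolding g by (simp add: algebra_simps)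
      then show ?thesis by simp
    qed
    have size: "nat (2 * int g + 1) = m" "nat (2 * int h + 1) = n"
      using g by auto
    have "zero_sum_arrays (digit_values (int h) {-int g..int g}) 1 (nat (2 * int g + 1)) (nat (2 * int h + 1))"
      using mn g by (intro zero_sum_array_odd_lt) auto
    moreover have "digit_values (int h) {-int g..int g} =
        {-(2 * int g * int h + int g + int h)..2 * int g * int h + int g + int h}"
      by (rule digit_values_interval) auto
    ultimately show ?thesis
      unfolding half size by metis
  qed
  show ?thesis
  proof (cases "m < n")
    case True
    then show ?thesis using lt assms by blast
  next
    case False
    then have "zero_sum_arrays {-((int (n * m) - 1) div 2)..(int (n * m) - 1) div 2} 1 n m"
      using lt[of n m] assms by simp
    then show ?thesis
      using zero_sum_arrays_transpose by (simp add: mult.commute)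
  qed
qed

section \<open>From one array to an odd number of copies\<close>

text \<open>The entries from index \<open>3\<close> on form \<open>t\<close> pairs
  \<open>-w, w\<close>, which cancel.\<close>

lemma sum_three_alternating:
  fixes u :: "nat \<Rightarrow> int"
  shows "(\<Sum>j<3 + 2 * t. if j < 3 then u j else (-1) ^ j * w) = u 0 + u 1 + u 2"
proof (induction t)
  case 0
  show ?case by (simp add: lessThan_nat_numeral lessThan_Suc)
next
  case (Suc t)
  have "3 + 2 * Suc t = Suc (Suc (3 + 2 * t))" by simp
  then show ?case
    using Suc by (simp only: sum.lessThan_Suc) simp
qed

lemma bij_betw_sign:
  fixes f :: "int \<Rightarrow> int"
  assumes "bij_betw f {-s..s} {-s..s}"
  shows "bij_betw (\<lambda>x. (-1) ^ j * f x) {-s..s} {-s..s}"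
proof (cases "even j")
  case True
  then show ?thesis using assms by simp
next
  case False
  then have "(\<lambda>x. (-1) ^ j * f x) = uminus \<circ> f"
    by auto
  then show ?thesis
    using bij_betw_trans[OF assms bij_uminus_symmetric] by simp
qed

text \<open>The labels of the copy \<open>k\<close> have leading digit taken from a single array and last digit given
  by a permutation of \<open>{-s..s}\<close> applied to \<open>k - s\<close>. The permutations form a matrix whose rows and
  columns have sum zero: a \<open>3 \<times> 3\<close> Latin square of three permutations with sum zero, bordered
  by alternating signs.\<close>

lemma zero_sum_arrays_odd_copies:
  fixes l :: int and s :: nat
  assumes "zero_sum_arrays {-l..l} 1 m n" "odd m" "odd n" "m > 1" "n > 1" "l \<ge> 0"
  shows "zero_sum_arrays (digit_values (int s) {-l..l}) (2 * s + 1) m n"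
proof -
  have card: "card {-l..l} = m * n"
    using assms(1) by (simp add: zero_sum_arrays_def)
  obtain f where "\<forall>k<1::nat. \<forall>i<m. \<forall>j<n. f k i j \<in> {-l..l}"
    "\<forall>x\<in>{-l..l}. \<exists>k<1. \<exists>i<m. \<exists>j<n. x = f k i j"
    "\<forall>k<1. \<forall>i<m. (\<Sum>j<n. f k i j) = 0" "\<forall>k<1. \<forall>j<n. (\<Sum>i<m. f k i j) = 0"
    using zero_sum_arraysD[OF assms(1)] by (elim exE conjE) (rule that)
  note f = this[rule_format]
  define p where "p u = (if u = 0 then (\<lambda>x. x) else if u = 1 then kotzig (int s) else kotzig_neg (int s))" for u :: nat
  have bij_p: "bij_betw (p u) {-int s..int s} {-int s..int s}" for u
    using bij_kotzig[of "int s"] bij_kotzig_neg[of "int s"] bij_betw_id[unfolded id_def] by (auto simp: p_def)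
  have sum_p: "p 0 x + p 1 x + p 2 x = 0" for x
    using kotzig_sum[of x "int s"] by (simp add: p_def kotzig_neg_def)
  \<comment> \<open>The formula is symmetric in \<open>i\<close> and \<open>j\<close>, and
    \<open>c_row\<close> holds for every odd length above \<open>1\<close>; so it settles the
    columns too.\<close>
  define c where "c i j e =
    (if i < 3 then (if j < 3 then p ((i + j) mod 3) e else (-1) ^ j * p i e)
     else (if j < 3 then (-1) ^ i * p j e else (-1) ^ j * ((-1) ^ i * e)))" for i j :: nat and e :: int
  have c_sym: "c i j e = c j i e" for i j e
    unfolding c_def by (simp add: add.commute)
  have bij_c: "bij_betw (c i j) {-int s..int s} {-int s..int s}" for i j
    unfolding c_def using bij_p bij_betw_id[unfolded id_def]
    by (cases "i < 3"; cases "j < 3") (auto intro!: bij_betw_sign)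
  have c_row: "(\<Sum>j<q. c i j e) = 0" if "odd q" "q > 1" for i q e
  proof -
    have "\<exists>t. q = 3 + 2 * t"
      using that by presburger
    then obtain t where q: "q = 3 + 2 * t" ..
    show ?thesis
    proof (cases "i < 3")
      case True
      then have "(\<Sum>j<q. c i j e) = p (i mod 3) e + p ((i + 1) mod 3) e + p ((i + 2) mod 3) e"
        unfolding c_def q using sum_three_alternating[where u = "\<lambda>j. p ((i + j) mod 3) e" and w = "p i e" and t = t] by simp
      moreover have "i = 0 \<or> i = 1 \<or> i = 2"
        using True by auto
      then have "p (i mod 3) e + p ((i + 1) mod 3) e + p ((i + 2) mod 3) e = 0"
        using sum_p[of e] by (elim disjE) (simp_all add: numeral_2_eq_2)
      ultimately show ?thesis by (rule trans)
    next
      case False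
      then have "(\<Sum>j<q. c i j e) = (-1) ^ i * p 0 e + (-1) ^ i * p 1 e + (-1) ^ i * p 2 e"
        unfolding c_def q using sum_three_alternating[where u = "\<lambda>j. (-1) ^ i * p j e" and w = "(-1) ^ i * e" and t = t] by simp
      also have "\<dots> = (-1) ^ i * (p 0 e + p 1 e + p 2 e)"
        by (simp only: distrib_left)
      finally show ?thesis
        using sum_p[of e] by simp
    qed
  qed
  \<comment> \<open>As \<open>k\<close> runs over the copies, \<open>int k - int s\<close> runs over
    all last digits. Since \<open>c i j\<close> is a permutation, each cell receives every last
    digit exactly once.\<close>
  define F where "F k i j = (2 * int s + 1) * f 0 i j + c i j (int k - int s)" for k i j
  show ?thesis
  proof (rule zero_sum_arraysI[where f = F])
    define M where "M = m * n"
    have "nat (2 * l + 1) = M"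
      using card unfolding M_def by simp
    then have M: "2 * l + 1 = int M"
      using assms(6) by linarith
    have "2 * (2 * l * int s + l + int s) + 1 = (2 * int s + 1) * (2 * l + 1)"
      by (simp add: algebra_simps)
    also have "\<dots> = int ((2 * s + 1) * M)"
      unfolding M by (simp add: algebra_simps)
    finally have "nat (2 * (2 * l * int s + l + int s) + 1) = (2 * s + 1) * M"
      by (simp only: nat_int)
    moreover have "card {-q..q} = nat (2 * q + 1)" for q :: int
      by simp
    ultimately show "card (digit_values (int s) {-l..l}) = (2 * s + 1) * m * n"
      unfolding M_def digit_values_interval[OF of_nat_0_le_iff assms(6)] by (simp only: mult.assoc)
    show "F k i j \<in> digit_values (int s) {-l..l}" if "k < 2 * s + 1" "i < m" "j < n" for k i j
    proof -
      have "c i j (int k - int s) \<in> {-int s..int s}"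
        using bij_betwE[OF bij_c] that by auto
      then show ?thesis
        unfolding mem_digit_values F_def using f(1)[OF zero_less_one that(2,3)] by blast
    qed
    show "\<exists>k<2 * s + 1. \<exists>i<m. \<exists>j<n. y = F k i j" if y': "y \<in> digit_values (int s) {-l..l}" for y
    proof -
      obtain a x where y: "a \<in> {-l..l}" "x \<in> {-int s..int s}" "y = (2 * int s + 1) * a + x"
        using y' unfolding mem_digit_values by blast
      obtain i j where ij: "i < m" "j < n" "a = f 0 i j"
        using f(2)[OF y(1)] by auto
      obtain e where e: "e \<in> {-int s..int s}" "x = c i j e"
        using bij_betw_imp_surj_on[OF bij_c[of i j]] y(2) by blast
      have "nat (e + int s) < 2 * s + 1" "y = F (nat (e + int s)) i j"
        using e y ij by (auto simp: F_def)
      then show ?thesis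
        using ij by blast
    qed
    show "(\<Sum>j<n. F k i j) = 0" if "i < m" for k i
      unfolding F_def using f(3)[of 0 i] c_row[of n] that assms
      by (simp add: sum.distrib flip: sum_distrib_left)
    show "(\<Sum>i<m. F k i j) = 0" if "j < n" for k j
      unfolding F_def c_sym[of _ j] using f(4)[of 0 j] c_row[of m] that assms
      by (simp add: sum.distrib flip: sum_distrib_left)
  qed
qed

section \<open>Labelings of disjoint copies\<close>

text \<open>The affine map from \<open>t\<close> to \<open>c * t - d\<close> centres the labels.
  Undoing it adds \<open>d\<close> to every entry, hence \<open>n * d\<close> to a row and
  \<open>m * d\<close> to a column.\<close>

lemma magic_arrays_of_zero_sum:
  fixes c d :: int
  assumes "zero_sum_arrays ((\<lambda>t. c * int t - d) ` {1..r * m * n}) r m n" "c > 0"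
  shows "\<exists>g :: nat \<Rightarrow> nat \<Rightarrow> nat \<Rightarrow> nat.
    bij_betw (\<lambda>(k, i, j). g k i j) ({..<r} \<times> {..<m} \<times> {..<n}) {1..r * m * n} \<and>
    (\<forall>k<r. \<forall>i<m. c * int (\<Sum>j<n. g k i j) = int n * d) \<and>
    (\<forall>k<r. \<forall>j<n. c * int (\<Sum>i<m. g k i j) = int m * d)"
proof -
  let ?V = "(\<lambda>t. c * int t - d) ` {1..r * m * n}" and ?T = "{..<r} \<times> {..<m} \<times> {..<n}"
  define V where "V = ?V"
  obtain f where f: "\<And>k i j. k < r \<Longrightarrow> i < m \<Longrightarrow> j < n \<Longrightarrow> f k i j \<in> V"
    "\<And>x. x \<in> V \<Longrightarrow> \<exists>k<r. \<exists>i<m. \<exists>j<n. x = f k i j"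
    "\<And>k i. k < r \<Longrightarrow> i < m \<Longrightarrow> (\<Sum>j<n. f k i j) = 0"
    "\<And>k j. k < r \<Longrightarrow> j < n \<Longrightarrow> (\<Sum>i<m. f k i j) = 0"
    using assms(1) unfolding V_def[symmetric] zero_sum_arrays_def by blast
  define g where "g k i j = nat ((f k i j + d) div c)" for k i j
  have g: "g k i j = t" if "f k i j = c * int t - d" for k i j t
    unfolding g_def using that assms(2) by simp
  have gf: "c * int (g k i j) = f k i j + d" "g k i j \<in> {1..r * m * n}" if "k < r" "i < m" "j < n" for k i j
  proof -
    have "f k i j \<in> V"
      using f(1) that .
    then obtain t where "f k i j = c * int t - d" "t \<in> {1..r * m * n}"
      unfolding V_def by (rule imageE)
    then show "c * int (g k i j) = f k i j + d" "g k i j \<in> {1..r * m * n}"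
      using g[of k i j t] by simp_all
  qed
  have "(\<lambda>(k, i, j). g k i j) ` ?T = {1..r * m * n}"
  proof
    show "(\<lambda>(k, i, j). g k i j) ` ?T \<subseteq> {1..r * m * n}"
    proof (rule image_subsetI)
      fix t
      assume "t \<in> ?T"
      then obtain k i j where "t = (k, i, j)" "k < r" "i < m" "j < n"
        by auto
      then show "(case t of (k, i, j) \<Rightarrow> g k i j) \<in> {1..r * m * n}"
        using gf(2)[of k i j] by simp
    qed
    show "{1..r * m * n} \<subseteq> (\<lambda>(k, i, j). g k i j) ` ?T"
    proof
      fix t
      assume "t \<in> {1..r * m * n}"
      then have "c * int t - d \<in> V"
        unfolding V_def by (rule imageI)
      then obtain k i j where "k < r" "i < m" "j < n" "c * int t - d = f k i j"
        using f(2) by blast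
      then show "t \<in> (\<lambda>(k, i, j). g k i j) ` ?T"
        using g[of k i j t] by (intro image_eqI[of _ _ "(k, i, j)"]) auto
    qed
  qed
  then have "bij_betw (\<lambda>(k, i, j). g k i j) ?T {1..r * m * n}"
    unfolding bij_betw_def by (auto intro!: eq_card_imp_inj_on simp: card_cartesian_product)
  moreover have "c * int (\<Sum>j<n. g k i j) = int n * d" if "k < r" "i < m" for k i
    using f(3)[OF that] gf(1)[OF that] by (simp add: sum_distrib_left sum.distrib)
  moreover have "c * int (\<Sum>i<m. g k i j) = int m * d" if "k < r" "j < n" for k j
    using f(4)[OF that] gf(1)[OF that(1) _ that(2)] by (simp add: sum_distrib_left sum.distrib)
  ultimately show ?thesis
    by (intro exI[of _ g] conjI) simp_all
qed

text \<open>Let \<open>N = r * m * n\<close>. If \<open>N\<close> is odd, the centre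
  \<open>(N + 1) / 2\<close> is an integer and \<open>c = 1\<close> works; for even sizes, doubling
  with \<open>c = 2\<close> and \<open>d = N + 1\<close> yields the odd integers below
  \<open>N\<close> in absolute value.\<close>

lemma magic_arrays_exist:
  assumes "m > 1" "n > 1" "m \<noteq> n"
    and "(odd m \<and> odd n \<and> odd r) \<or> (even m \<and> even n \<and> (m, n) \<noteq> (2, 2))"
  obtains c d :: int where "c > 0" "d > 0"
    "zero_sum_arrays ((\<lambda>t. c * int t - d) ` {1..r * m * n}) r m n"
  using assms(4)
proof (elim disjE conjE)
  assume "odd m" "odd n" "odd r"
  define l where "l = (int (m * n) - 1) div 2"
  have "odd (int (m * n))"
    using \<open>odd m\<close> \<open>odd n\<close> by simp
  then have l: "int (m * n) = 2 * l + 1"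
    unfolding l_def by presburger
  have "m * n > 0" using assms by simp
  then have "l \<ge> 0" using l by linarith
  obtain s where s: "r = 2 * s + 1"
    using \<open>odd r\<close> by (metis oddE)
  define L where "L = 2 * l * int s + l + int s"
  have "L \<ge> 0"
    using \<open>l \<ge> 0\<close> unfolding L_def by simp
  define N where "N = r * m * n"
  have "int N = int r * int (m * n)"
    unfolding N_def by simp
  then have L: "int N = 2 * L + 1"
    unfolding l L_def s by (simp add: algebra_simps)
  have "zero_sum_arrays {-l..l} 1 m n"
    using zero_sum_array_odd_single \<open>odd m\<close> \<open>odd n\<close> assms unfolding l_def by blast
  then have "zero_sum_arrays (digit_values (int s) {-l..l}) r m n"
    unfolding s using \<open>odd m\<close> \<open>odd n\<close> assms \<open>l \<ge> 0\<close> by (intro zero_sum_arrays_odd_copies) auto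
  moreover have "digit_values (int s) {-l..l} = {-L..L}"
    unfolding L_def using \<open>l \<ge> 0\<close> by (intro digit_values_interval) auto
  moreover have "(\<lambda>t. 1 * int t - (L + 1)) ` {1..N} = {-L..L}"
  proof
    show "{-L..L} \<subseteq> (\<lambda>t. 1 * int t - (L + 1)) ` {1..N}"
    proof
      fix x
      assume "x \<in> {-L..L}"
      then show "x \<in> (\<lambda>t. 1 * int t - (L + 1)) ` {1..N}"
        using L by (intro image_eqI[of _ _ "nat (x + L + 1)"]) auto
    qed
  qed (use L in auto)
  ultimately show ?thesis
    using \<open>L \<ge> 0\<close> that[of 1 "L + 1"] unfolding N_def by simp
next
  assume "even m" "even n" "(m, n) \<noteq> (2, 2)"
  define N where "N = r * m * n"
  have "even N" unfolding N_def using \<open>even m\<close> by simp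
  have "(\<lambda>t. 2 * int t - (int N + 1)) ` {1..N} = {x. odd x \<and> \<bar>x\<bar> < int N}"
  proof
    show "(\<lambda>t. 2 * int t - (int N + 1)) ` {1..N} \<subseteq> {x. odd x \<and> \<bar>x\<bar> < int N}"
      using \<open>even N\<close> by auto
    show "{x. odd x \<and> \<bar>x\<bar> < int N} \<subseteq> (\<lambda>t. 2 * int t - (int N + 1)) ` {1..N}"
    proof
      fix x
      assume "x \<in> {x. odd x \<and> \<bar>x\<bar> < int N}"
      then have x: "even (x + int N + 1)" "\<bar>x\<bar> < int N"
        using \<open>even N\<close> by auto
      then obtain y where y: "x + int N + 1 = 2 * y" by blast
      then show "x \<in> (\<lambda>t. 2 * int t - (int N + 1)) ` {1..N}"
        using x by (intro image_eqI[of _ _ "nat y"]) auto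
    qed
  qed
  then show ?thesis
    using zero_sum_arrays_even[of m n r] \<open>even m\<close> \<open>even n\<close> \<open>(m, n) \<noteq> (2, 2)\<close> assms that[of 2 "int N + 1"]
    unfolding N_def by simp
qed

section \<open>Edges of the copies and the bounds on the number of colours\<close>

definition copy_edge :: "nat \<times> nat \<times> nat \<Rightarrow> (nat \<times> (nat + nat)) set" where
  "copy_edge = (\<lambda>(k, i, j). {(k, Inl i), (k, Inr j)})"

lemma inj_copy_edge: "inj copy_edge"
  unfolding copy_edge_def by (auto simp: inj_def doubleton_eq_iff)

lemma edges_copies:
  "edges (disjoint_copies r (complete_bipartite m n)) = copy_edge ` ({..<r} \<times> {..<m} \<times> {..<n})"
proof -
  have copy_edge: "copy_edge (k, i, j) = Pair k ` {Inl i, Inr j}" for k i j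
    unfolding copy_edge_def by simp
  have flatten: "{f k e | k e. k < r \<and> e \<in> {h i j | i j. i < m \<and> j < n}} =
      {f k (h i j) | k i j. k < r \<and> i < m \<and> j < n}"
    for f :: "nat \<Rightarrow> 'a \<Rightarrow> 'b" and h :: "nat \<Rightarrow> nat \<Rightarrow> 'a"
    by blast
  have "edges (disjoint_copies r (complete_bipartite m n)) =
      {Pair k ` {Inl i, Inr j} | k i j. k < r \<and> i < m \<and> j < n}"
    unfolding disjoint_copies_def complete_bipartite_def ugraph.select_convs by (rule flatten)
  also have "\<dots> = {copy_edge (k, i, j) | k i j. k < r \<and> i < m \<and> j < n}"
    unfolding copy_edge ..
  also have "\<dots> = copy_edge ` {(k, i, j) | k i j. k < r \<and> i < m \<and> j < n}"
    by blast
  also have "{(k, i, j) | k i j. k < r \<and> i < m \<and> j < n} = {..<r} \<times> {..<m} \<times> {..<n}"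
    by auto
  finally show ?thesis .
qed

text \<open>The weights of the vertices \<open>(k, Inl i)\<close> are row sums and those of
  \<open>(k, Inr j)\<close> column sums. Every edge joins the two kinds, so
  \<open>R \<noteq> C\<close> makes the labeling local antimagic.\<close>

lemma chi_la_copies_le_two:
  fixes g :: "nat \<Rightarrow> nat \<Rightarrow> nat \<Rightarrow> nat"
  assumes g: "bij_betw (\<lambda>(k, i, j). g k i j) ({..<r} \<times> {..<m} \<times> {..<n}) {1..r * m * n}"
    and rows: "\<And>k i. k < r \<Longrightarrow> i < m \<Longrightarrow> (\<Sum>j<n. g k i j) = R"
    and cols: "\<And>k j. k < r \<Longrightarrow> j < n \<Longrightarrow> (\<Sum>i<m. g k i j) = C"
    and "R \<noteq> C"
  shows "chi_la (disjoint_copies r (complete_bipartite m n)) \<le> 2"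
proof -
  let ?G = "disjoint_copies r (complete_bipartite m n)" and ?T = "{..<r} \<times> {..<m} \<times> {..<n}"
  define f where "f e = (case inv copy_edge e of (k, i, j) \<Rightarrow> g k i j)" for e
  have f: "f (copy_edge (k, i, j)) = g k i j" for k i j
    unfolding f_def by (simp add: inv_f_f[OF inj_copy_edge])
  have inj: "inj_on copy_edge S" for S
    using inj_copy_edge by (rule inj_on_subset) simp
  have row: "weight ?G f (k, Inl i) = R" if "k < r" "i < m" for k i
  proof -
    have "incident_edges ?G (k, Inl i) = (\<lambda>j. copy_edge (k, i, j)) ` {..<n}"
      unfolding incident_edges_def edges_copies using that by (auto simp: copy_edge_def)
    moreover have "inj_on (\<lambda>j. copy_edge (k, i, j)) {..<n}"
      using inj_copy_edge by (auto simp: inj_on_def inj_def)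
    ultimately show ?thesis
      unfolding weight_def using rows that by (simp add: sum.reindex f)
  qed
  have col: "weight ?G f (k, Inr j) = C" if "k < r" "j < n" for k j
  proof -
    have "incident_edges ?G (k, Inr j) = (\<lambda>i. copy_edge (k, i, j)) ` {..<m}"
      unfolding incident_edges_def edges_copies using that by (auto simp: copy_edge_def)
    moreover have "inj_on (\<lambda>i. copy_edge (k, i, j)) {..<m}"
      using inj_copy_edge by (auto simp: inj_on_def inj_def)
    ultimately show ?thesis
      unfolding weight_def using cols that by (simp add: sum.reindex f)
  qed
  have "local_antimagic_labeling ?G f"
    unfolding local_antimagic_labeling_def
  proof (intro conjI allI impI)
    have "card (edges ?G) = r * m * n"
      unfolding edges_copies by (simp add: card_image[OF inj] card_cartesian_product)
    moreover have "bij_betw (f \<circ> copy_edge) ?T {1..r * m * n}"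
      using g by (rule bij_betw_cong[THEN iffD1, rotated]) (auto simp: f)
    ultimately show "bij_betw f (edges ?G) {1..card (edges ?G)}"
      unfolding edges_copies using bij_betw_comp_iff[OF inj_on_imp_bij_betw[OF inj]] by metis
    fix u v
    assume "{u, v} \<in> edges ?G"
    then obtain k i j where "k < r" "i < m" "j < n" "{u, v} = {(k, Inl i), (k, Inr j)}"
      unfolding edges_copies copy_edge_def by auto
    then show "weight ?G f u \<noteq> weight ?G f v"
      using row col \<open>R \<noteq> C\<close> by (auto simp: doubleton_eq_iff)
  qed
  then have "chi_la ?G \<le> enat (card (weight ?G f ` verts ?G))"
    unfolding chi_la_def by (intro INF_lower) simp
  also have "weight ?G f ` verts ?G \<subseteq> {R, C}"
    using row col by (auto simp: disjoint_copies_def complete_bipartite_def)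
  then have "card (weight ?G f ` verts ?G) \<le> card {R, C}"
    by (intro card_mono) auto
  also have "card {R, C} \<le> 2"
    using \<open>R \<noteq> C\<close> by simp
  finally show ?thesis
    by (simp add: numeral_eq_enat)
qed

text \<open>Each labeling gives the two ends of the edge different weights, so \<open>2\<close>
  bounds every member of the infimum.\<close>

lemma chi_la_ge_two:
  assumes "finite (verts G)" "{u, v} \<in> edges G" "u \<in> verts G" "v \<in> verts G"
  shows "2 \<le> chi_la G"
  unfolding chi_la_def
proof (rule INF_greatest)
  fix f
  assume "f \<in> {f. local_antimagic_labeling G f}"
  then have "weight G f u \<noteq> weight G f v"
    using assms(2) unfolding local_antimagic_labeling_def by blast
  then have "2 = card {weight G f u, weight G f v}"
    by simp
  also have "\<dots> \<le> card (weight G f ` verts G)"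
    using assms by (intro card_mono) auto
  finally show "2 \<le> enat (card (weight G f ` verts G))"
    by (simp add: numeral_eq_enat)
qed

theorem theorem2p1:
  fixes m n r :: nat
  assumes "m > 1" and "n > 1" and "m \<noteq> n" and "r > 0"
    and "(odd m \<and> odd n \<and> odd r) \<or> (even m \<and> even n \<and> (m, n) \<noteq> (2, 2))"
  shows "chi_la (disjoint_copies r (complete_bipartite m n)) = 2"
proof (rule antisym)
  let ?G = "disjoint_copies r (complete_bipartite m n)"
  obtain c d :: int where "c > 0" "d > 0"
    and zs: "zero_sum_arrays ((\<lambda>t. c * int t - d) ` {1..r * m * n}) r m n"
    using magic_arrays_exist[OF assms(1-3,5)] by blast
  obtain g where g: "bij_betw (\<lambda>(k, i, j). g k i j) ({..<r} \<times> {..<m} \<times> {..<n}) {1..r * m * n}"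
    and rows: "\<forall>k<r. \<forall>i<m. c * int (\<Sum>j<n. g k i j) = int n * d"
    and cols: "\<forall>k<r. \<forall>j<n. c * int (\<Sum>i<m. g k i j) = int m * d"
    using magic_arrays_of_zero_sum[OF zs \<open>c > 0\<close>] by blast
  show "chi_la ?G \<le> 2"
  proof (rule chi_la_copies_le_two[OF g])
    \<comment> \<open>Row \<open>0\<close> and column \<open>0\<close> of array \<open>0\<close>
      serve as reference; they exist because \<open>r\<close>, \<open>m\<close> and \<open>n\<close>
      are positive.\<close>
    let ?R = "\<Sum>j<n. g 0 0 j" and ?C = "\<Sum>i<m. g 0 i 0"
    have R: "c * int ?R = int n * d" and C: "c * int ?C = int m * d"
      using rows cols assms by simp_all
    show "(\<Sum>j<n. g k i j) = ?R" if "k < r" "i < m" for k i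
    proof -
      have "c * int (\<Sum>j<n. g k i j) = c * int ?R"
        using rows that unfolding R by blast
      then show ?thesis
        using \<open>c > 0\<close> by (simp del: of_nat_sum)
    qed
    show "(\<Sum>i<m. g k i j) = ?C" if "k < r" "j < n" for k j
    proof -
      have "c * int (\<Sum>i<m. g k i j) = c * int ?C"
        using cols that unfolding C by blast
      then show ?thesis
        using \<open>c > 0\<close> by (simp del: of_nat_sum)
    qed
    show "?R \<noteq> ?C"
    proof
      assume eq: "?R = ?C"
      have "int n * d = int m * d"
        unfolding R[symmetric] C[symmetric] eq ..
      then show False
        using \<open>d > 0\<close> \<open>m \<noteq> n\<close> by simp
    qed
  qed
  have "(0, 0, 0) \<in> {..<r} \<times> {..<m} \<times> {..<n}"
    using assms by simp
  then have "copy_edge (0, 0, 0) \<in> edges ?G"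
    unfolding edges_copies by (rule imageI)
  then have "{(0, Inl 0), (0, Inr 0)} \<in> edges ?G"
    unfolding copy_edge_def by simp
  then show "2 \<le> chi_la ?G"
  proof (rule chi_la_ge_two[rotated])
    show "finite (verts ?G)"
      by (simp add: disjoint_copies_def complete_bipartite_def)
    show "(0, Inl 0) \<in> verts ?G" "(0, Inr 0) \<in> verts ?G"
      using assms by (simp_all add: disjoint_copies_def complete_bipartite_def InlI InrI)
  qed
qed

end
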